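(* Consider the modified SD algorithm (defined in the context) for the Kantorovich ball problem, with either the entropy or the Euclidean distance. Put $\tilde C_p=\sqrt K$, and - for the entropy distance: $\tilde\tau=\tau_q$ and $\tilde\Omega_P^2=\Omega_H^2$; - for the Euclidean distance: $\tilde\tau=\tau_q/K$ and $\tilde\Omega_P^2=K\Omega_H^2$. If the stepsizes $\sigma,\tau_q,\eta>0$ satisfy $\eta\ge\frac{\tilde C_p^2M_T^2M_\Pi^2}{\tilde\tau}+\frac{M_T^2}{\sigma}$, then after $N$ iterations $\bar x_N=\frac1N\sum_{t=1}^Nx_t$ satisfies $$f(\bar x_N)-f(x^* )\le\frac{\sigma\Omega_\Pi^2+\tilde\tau\tilde\Omega_P^2+\eta\Omega_X^2}{N}.$$ In particular, with $\sigma=M_T\frac{\Omega_X}{\Omega_\Pi}$, $\tilde\tau=M_TM_\Pi\tilde C_p\frac{\Omega_X}{\tilde\Omega_P}$ and $\eta=M_TM_\Pi\tilde C_p\frac{\tilde\Omega_P}{\Omega_X}+M_T\frac{\Omega_\Pi}{\Omega_X}$, $$f(\bar x_N)-f(x^* )\le\frac{2\Omega_XM_T}{N}\bigl(\Omega_\Pi+\tilde C_pM_\Pi\tilde\Omega_P\bigr).$$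
   Context: Problem. $X\subset\mathbb{R}^n$ is nonempty, convex and compact; $f_0:X\to\mathbb{R}$ is closed convex and Lipschitz; for $k=1,\dots,K$, $T_k\in\mathbb{R}^{m_k\times n}$, $g_k:\mathbb{R}^{m_k}\to\mathbb{R}$ is convex and Lipschitz with conjugate $g_k^*$, $\Pi(k)=\{g_k^*<\infty\}$, $\Pi=\Pi(1)\times\cdots\times\Pi(K)$. Let $D\in\mathbb{R}_+^{K\times K}$ be a distance matrix, $\delta\ge0$, $\bar p=(1/K,\dots,1/K)$, and let $\mathcal H_\delta$ be the (nonempty) set of $H\in\mathbb{R}_+^{K\times K}$ with $\sum_jH_{i,j}=\bar p_i$ for all $i$ and $\sum_{i,j}D_{i,j}H_{i,j}\le\delta$. For a matrix $H$ with rows $H_1,\dots,H_K$ let $q(H)=\sum_iH_i\in\mathbb{R}^K$ (column sums). The Kantorovich ball is $P_\delta=\{q(H):H\in\mathcal H_\delta\}$; $f(x)=f_0(x)+\max_{p\in P_\delta}\sum_kp_kg_k(T_kx)$ and $x^*$ minimizes $f$ over $X$. Distances. $V(x,x')=\frac12\|x-x'\|_2^2$, $U(\pi_k,\pi_k')=\frac12\|\pi_k-\pi_k'\|_2^2$. For nonnegative vectors $h,h'\in\mathbb{R}^K$ with entries summing to $1/K$: Euclidean distance $W(h,h')=\frac12\|h-h'\|_2^2$; entropy distance $W(h,h')=\sum_jh_j'\log(h_j'/h_j)$ ($h$ positive; the iterates $H_t$ are assumed to be such that $W$ is defined). $\mathbf W(H,H')=\sum_iW(H_i,H_i')$. Constants.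 $\Omega_X^2=\max_{x\in X}V(x_0,x)$, $\Omega_\Pi^2=\max_k\sup_{\pi_k\in\Pi(k)}U(\pi_{0,k},\pi_k)$, $\Omega_H^2=\max_{H\in\mathcal H_\delta}\mathbf W(H_0,H)$, $M_T=\max_k\|T_k\|_{2,2}$, $M_\Pi=\max_k\sup_{\pi_k\in\Pi(k)}\|\pi_k\|_2$. For the particular stepsizes these constants are assumed positive. Modified SD algorithm with stepsizes $\sigma,\tau_q,\eta>0$: $x_0\in X$, $\pi_0\in\Pi$, $H_0$ the matrix with all entries $1/K^2$, $x_{-1}=x_0$; for $t=1,\dots,N$: (1) $\tilde x_t=2x_{t-1}-x_{t-2}$; (2) $\pi_{k,t}=\arg\max_{\pi_k\in\Pi(k)}\langle T_k\tilde x_t,\pi_k\rangle-g_k^*(\pi_k)-\sigma U(\pi_{k,t-1},\pi_k)$ for every $k$; (3) $\tilde f_{t,k}=\langle T_kx_{t-1},\pi_{k,t}\rangle+\langle T_k(x_{t-1}-x_{t-2}),\pi_{k,t-1}\rangle-g_k^*(\pi_{k,t})$; (4) $H_t=\arg\max_{H\in\mathcal H_\delta}\langle q(H),\tilde f_t\rangle-\tau_q\mathbf W(H_{t-1},H)$, $q_t=q(H_t)$; (5) $x_t=\arg\min_{x\in X}f_0(x)+\sum_kq_{t,k}\langle T_kx,\pi_{k,t}\rangle+\eta V(x_{t-1},x)$. *)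

theory Defs
  imports "HOL-Analysis.Analysis"
begin

text \<open>
  The dimensions \<open>m\<^sub>k\<close> vary with the scenario \<open>k\<close>. The space of dimension \<open>m\<^sub>k\<close> is rendered as the
  coordinate subspace of \<open>real^'m\<close> carried by an index set \<open>J = I k\<close> with \<open>m\<^sub>k = card (I k)\<close>;
  every finite family of dimensions arises in this way once \<open>'m\<close> is large enough.
  Functions \<open>g k\<close> are only ever used on that subspace.
\<close>

definition coord_space :: "'m::finite set \<Rightarrow> (real^'m) set" where
  "coord_space J = {y. \<forall>i. i \<notin> J \<longrightarrow> y $ i = 0}"

definition conjugate :: "'m::finite set \<Rightarrow> (real^'m \<Rightarrow> real) \<Rightarrow> real^'m \<Rightarrow> ereal" where
  "conjugate J g p = (SUP y\<in>coord_space J. ereal (y \<bullet> p - g y))"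

definition dual_dom :: "'m::finite set \<Rightarrow> (real^'m \<Rightarrow> real) \<Rightarrow> (real^'m) set" where
  "dual_dom J g = {p \<in> coord_space J. conjugate J g p < \<infinity>}"

text \<open>The conjugate as a real number; only used on \<^term>\<open>dual_dom J g\<close>, where it is finite.\<close>

definition conj_val :: "'m::finite set \<Rightarrow> (real^'m \<Rightarrow> real) \<Rightarrow> real^'m \<Rightarrow> real" where
  "conj_val J g p = real_of_ereal (conjugate J g p)"

definition half_sq_dist :: "'a::real_normed_vector \<Rightarrow> 'a \<Rightarrow> real" where
  "half_sq_dist u v = (norm (u - v))\<^sup>2 / 2"

text \<open>In a matrix \<open>H :: real^'k^'k\<close> the vector \<open>H $ i\<close> is the \<open>i\<close>-th row, so this is the vector of
  column sums.\<close>

definition col_sums :: "real^'k^'k::finite \<Rightarrow> real^'k" where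
  "col_sums H = (\<Sum>i\<in>UNIV. H $ i)"

definition transport_plans :: "real^'k^'k::finite \<Rightarrow> real \<Rightarrow> (real^'k^'k) set" where
  "transport_plans D \<delta> =
     {H. (\<forall>i j. 0 \<le> H $ i $ j) \<and>
         (\<forall>i. (\<Sum>j\<in>UNIV. H $ i $ j) = 1 / real CARD('k)) \<and>
         (\<Sum>i\<in>UNIV. \<Sum>j\<in>UNIV. D $ i $ j * H $ i $ j) \<le> \<delta>}"

definition kantorovich_ball :: "real^'k^'k::finite \<Rightarrow> real \<Rightarrow> (real^'k) set" where
  "kantorovich_ball D \<delta> = col_sums ` transport_plans D \<delta>"

definition risk_objective ::
  "(real^'n \<Rightarrow> real) \<Rightarrow> ('k::finite \<Rightarrow> real^'n^'m) \<Rightarrow> ('k \<Rightarrow> real^'m \<Rightarrow> real) \<Rightarrow>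
   real^'k^'k \<Rightarrow> real \<Rightarrow> real^'n::finite \<Rightarrow> real" where
  "risk_objective f\<^sub>0 T g D \<delta> x =
     f\<^sub>0 x + (SUP p\<in>kantorovich_ball D \<delta>. \<Sum>k\<in>UNIV. p $ k * g k (T k *v x))"

datatype distance = Entropy | Euclidean

text \<open>The first argument of the entropy distance is meant to be positive. A zero entry of the second
  argument contributes \<open>0\<close>, in accordance with the usual convention for \<open>0 * ln 0\<close>.\<close>

fun row_dist :: "distance \<Rightarrow> real^'k::finite \<Rightarrow> real^'k \<Rightarrow> real" where
  "row_dist Entropy h h' = (\<Sum>j\<in>UNIV. h' $ j * ln (h' $ j / h $ j))"
| "row_dist Euclidean h h' = half_sq_dist h h'"

definition mat_dist :: "distance \<Rightarrow> real^'k^'k::finite \<Rightarrow> real^'k^'k \<Rightarrow> real" where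
  "mat_dist W H H' = (\<Sum>i\<in>UNIV. row_dist W (H $ i) (H' $ i))"

text \<open>
  In the next three definitions \<open>x t\<close>, \<open>\<pi> t k\<close>, \<open>H t\<close> are the iterates. They are evaluated for
  \<open>t \<ge> 1\<close> only, and subtraction on \<^typ>\<open>nat\<close> truncates: for \<open>t = 1\<close> the expression \<open>x (t - 2)\<close>
  is \<open>x 0\<close>, which is exactly the convention \<open>x\<^sub>-\<^sub>1 = x\<^sub>0\<close>.
\<close>

definition extrapolated :: "(nat \<Rightarrow> real^'n::finite) \<Rightarrow> nat \<Rightarrow> real^'n" where
  "extrapolated x t = 2 *\<^sub>R x (t - 1) - x (t - 2)"

definition f_tilde ::
  "('k::finite \<Rightarrow> 'm::finite set) \<Rightarrow> ('k \<Rightarrow> real^'n::finite^'m) \<Rightarrow> ('k \<Rightarrow> real^'m \<Rightarrow> real) \<Rightarrow>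
   (nat \<Rightarrow> real^'n) \<Rightarrow> (nat \<Rightarrow> 'k \<Rightarrow> real^'m) \<Rightarrow> nat \<Rightarrow> real^'k" where
  "f_tilde I T g x \<pi> t =
     (\<chi> k. (T k *v x (t - 1)) \<bullet> \<pi> t k
          + (T k *v (x (t - 1) - x (t - 2))) \<bullet> \<pi> (t - 1) k
          - conj_val (I k) (g k) (\<pi> t k))"

definition sd_iterates ::
  "distance \<Rightarrow> (real^'n::finite) set \<Rightarrow> (real^'n \<Rightarrow> real) \<Rightarrow> ('k::finite \<Rightarrow> 'm::finite set) \<Rightarrow>
   ('k \<Rightarrow> real^'n^'m) \<Rightarrow> ('k \<Rightarrow> real^'m \<Rightarrow> real) \<Rightarrow> real^'k^'k \<Rightarrow> real \<Rightarrow>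
   real \<Rightarrow> real \<Rightarrow> real \<Rightarrow> nat \<Rightarrow>
   (nat \<Rightarrow> real^'n) \<Rightarrow> (nat \<Rightarrow> 'k \<Rightarrow> real^'m) \<Rightarrow> (nat \<Rightarrow> real^'k^'k) \<Rightarrow> bool" where
  "sd_iterates W X f\<^sub>0 I T g D \<delta> \<sigma> \<tau>\<^sub>q \<eta> N x \<pi> H \<longleftrightarrow>
     x 0 \<in> X \<and>
     (\<forall>k. \<pi> 0 k \<in> dual_dom (I k) (g k)) \<and>
     H 0 = (\<chi> i j. 1 / (real CARD('k))\<^sup>2) \<and>
     (\<forall>t\<in>{1..N}.
        (\<forall>k. is_arg_max
               (\<lambda>p. (T k *v extrapolated x t) \<bullet> p - conj_val (I k) (g k) p
                      - \<sigma> * half_sq_dist (\<pi> (t - 1) k) p)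
               (\<lambda>p. p \<in> dual_dom (I k) (g k)) (\<pi> t k)) \<and>
        is_arg_max
          (\<lambda>G. col_sums G \<bullet> f_tilde I T g x \<pi> t - \<tau>\<^sub>q * mat_dist W (H (t - 1)) G)
          (\<lambda>G. G \<in> transport_plans D \<delta>) (H t) \<and>
        is_arg_min
          (\<lambda>y. f\<^sub>0 y + (\<Sum>k\<in>UNIV. col_sums (H t) $ k * ((T k *v y) \<bullet> \<pi> t k))
                 + \<eta> * half_sq_dist (x (t - 1)) y)
          (\<lambda>y. y \<in> X) (x t))"

end

theory Submission
  imports Defs
begin

text \<open>
  Writing \<open>g\<^sub>k\<close> through its conjugate turns the problem into a saddle point problem for the function
  \<open>L(x, \<pi>, q)\<close> which is convex in \<open>x\<close> and concave in \<open>\<pi>\<close> and in \<open>q\<close> separately. The gap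
  \<open>L(x\<^sub>t, \<pi>, q) - L(y, \<pi>\<^sub>t, q\<^sub>t)\<close> splits into three differences, in each of which a single block
  changes and which the three-point inequality of the corresponding proximal step controls. The
  extrapolated \<open>x\<close> and the correction term in the definition of \<open>f_tilde\<close> are chosen so that the
  errors made by using old values of \<open>x\<close> telescope, up to products of \<open>x\<^sub>t - x\<^sub>t\<^sub>-\<^sub>1\<close> with a change
  of \<open>\<pi>\<close> or of \<open>q\<close>. The condition on \<open>\<eta>\<close> lets the proximal terms absorb these products; for \<open>q\<close> this
  uses that the matrix distance dominates the squared \<open>l\<^sub>1\<close> distance of the column sums, by Pinsker's
  inequality for the entropy and by Cauchy-Schwarz over all \<open>K\<^sup>2\<close> entries for the Euclidean distance.
\<close>

section \<open>Proximal steps and conjugates\<close>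

lemma half_sq_dist_nonneg [simp]: "0 \<le> half_sq_dist u v"
  by (simp add: half_sq_dist_def)

lemma half_sq_dist_self [simp]: "half_sq_dist u u = 0"
  by (simp add: half_sq_dist_def)

lemma half_sq_dist_convex_combination:
  fixes u v z :: "'a::real_inner"
  shows "half_sq_dist z ((1 - s) *\<^sub>R u + s *\<^sub>R v)
    = (1 - s) * half_sq_dist z u + s * half_sq_dist z v - s * (1 - s) * half_sq_dist u v"
  unfolding half_sq_dist_def power2_norm_eq_inner
  by (simp add: inner_commute algebra_simps) (simp add: field_simps)

text \<open>Comparing the minimizer \<open>u\<close> with
  \<open>(1 - s) *\<^sub>R u + s *\<^sub>R v\<close> leaves the strong convexity gain
  \<open>s * (1 - s) * c * half_sq_dist u v\<close>. Division by \<open>s\<close> keeps the factor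
  \<open>r = 1 - s\<close>, which then tends to 1.\<close>

lemma half_sq_dist_prox:
  fixes \<phi> :: "'a::real_inner \<Rightarrow> real"
  assumes \<phi>: "convex_on S \<phi>" and uv: "u \<in> S" "v \<in> S"
    and min: "\<And>w. w \<in> S \<Longrightarrow> \<phi> u + c * half_sq_dist z u \<le> \<phi> w + c * half_sq_dist z w"
  shows "\<phi> u + c * half_sq_dist z u + c * half_sq_dist u v \<le> \<phi> v + c * half_sq_dist z v"
proof -
  have "r * (c * half_sq_dist u v) \<le> \<phi> v + c * half_sq_dist z v - \<phi> u - c * half_sq_dist z u"
    if r: "0 < r" "r < 1" for r
  proof -
    define s where "s = 1 - r"
    have s: "0 < s" "s < 1" using r by (auto simp: s_def)
    define w where "w = (1 - s) *\<^sub>R u + s *\<^sub>R v"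
    have "w \<in> S" unfolding w_def
      using convex_on_imp_convex[OF \<phi>] uv s by (intro convexD) auto
    moreover have "\<phi> w \<le> (1 - s) * \<phi> u + s * \<phi> v"
      unfolding w_def using convex_onD[OF \<phi>] s uv by simp
    ultimately have "\<phi> u + c * half_sq_dist z u \<le> (1 - s) * \<phi> u + s * \<phi> v + c * half_sq_dist z w"
      using min[of w] by linarith
    then have "s * (r * (c * half_sq_dist u v))
        \<le> s * (\<phi> v + c * half_sq_dist z v - \<phi> u - c * half_sq_dist z u)"
      unfolding w_def half_sq_dist_convex_combination by (simp add: s_def algebra_simps)
    then show ?thesis using s by simp
  qed
  then have "c * half_sq_dist u v \<le> \<phi> v + c * half_sq_dist z v - \<phi> u - c * half_sq_dist z u"
    by (rule field_le_mult_one_interval)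
  then show ?thesis by simp
qed

section \<open>Fenchel conjugates: finiteness, convexity, bounded domain, subgradients\<close>

lemma coord_space_closed_ops:
  "0 \<in> coord_space J" "y \<in> coord_space J \<Longrightarrow> r *\<^sub>R y \<in> coord_space J"
  "y \<in> coord_space J \<Longrightarrow> z \<in> coord_space J \<Longrightarrow> y + z \<in> coord_space J"
  by (auto simp: coord_space_def)

text \<open>The supremum includes \<open>y = 0\<close>, so the conjugate is never -\<infinity>, and
  on its domain the passage to reals loses nothing.\<close>

lemma conjugate_eq_conj_val:
  assumes "p \<in> dual_dom J g"
  shows "conjugate J g p = ereal (conj_val J g p)"
proof -
  have "ereal (0 \<bullet> p - g 0) \<le> conjugate J g p"
    unfolding conjugate_def by (rule SUP_upper) (rule coord_space_closed_ops)
  then have "conjugate J g p \<noteq> -\<infinity>" by auto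
  moreover have "conjugate J g p \<noteq> \<infinity>" using assms by (auto simp: dual_dom_def)
  ultimately show ?thesis by (cases "conjugate J g p") (auto simp: conj_val_def)
qed

lemma fenchel_inequality:
  assumes "p \<in> dual_dom J g" "y \<in> coord_space J"
  shows "y \<bullet> p - conj_val J g p \<le> g y"
proof -
  have "ereal (y \<bullet> p - g y) \<le> conjugate J g p"
    unfolding conjugate_def by (rule SUP_upper) fact
  then show ?thesis using conjugate_eq_conj_val[OF assms(1)] by simp
qed

lemma conj_val_leI:
  assumes p: "p \<in> coord_space J" and le: "\<And>y. y \<in> coord_space J \<Longrightarrow> y \<bullet> p - g y \<le> c"
  shows "p \<in> dual_dom J g" "conj_val J g p \<le> c"
proof -
  have le': "conjugate J g p \<le> ereal c"
    unfolding conjugate_def by (rule SUP_least) (simp add: le)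
  then show dom: "p \<in> dual_dom J g" using p by (auto simp: dual_dom_def)
  show "conj_val J g p \<le> c" using le' conjugate_eq_conj_val[OF dom] by simp
qed

text \<open>A supremum of affine functions is convex. A weighted sum of two Fenchel inequalities,
  fed to \<open>conj_val_leI\<close>, yields the convexity of the domain and of the values at
  once.\<close>

lemma convex_on_conj_val: "convex_on (dual_dom J g) (conj_val J g)"
proof -
  have *: "u *\<^sub>R p + v *\<^sub>R q \<in> dual_dom J g \<and>
      conj_val J g (u *\<^sub>R p + v *\<^sub>R q) \<le> u * conj_val J g p + v * conj_val J g q"
    if pq: "p \<in> dual_dom J g" "q \<in> dual_dom J g" and uv: "0 \<le> u" "0 \<le> v" "u + v = 1" for p q u v
  proof -
    have "y \<bullet> (u *\<^sub>R p + v *\<^sub>R q) - g y \<le> u * conj_val J g p + v * conj_val J g q"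
      if y: "y \<in> coord_space J" for y
    proof -
      have "u * (y \<bullet> p - conj_val J g p) + v * (y \<bullet> q - conj_val J g q) \<le> u * g y + v * g y"
        using fenchel_inequality[OF pq(1) y] fenchel_inequality[OF pq(2) y] uv
        by (intro add_mono mult_left_mono)
      also have "u * g y + v * g y = g y" using uv by (metis distrib_right mult_1)
      finally show ?thesis by (simp add: inner_add_right algebra_simps)
    qed
    moreover have "u *\<^sub>R p + v *\<^sub>R q \<in> coord_space J"
      using pq by (auto simp: dual_dom_def intro!: coord_space_closed_ops)
    ultimately show ?thesis using conj_val_leI by blast
  qed
  then show ?thesis by (auto intro!: convex_onI simp: convex_def)
qed

text \<open>Along the ray \<open>s *\<^sub>R p\<close> the pairing with \<open>p\<close> grows like
  \<open>s * (norm p)\<^sup>2\<close> and \<open>g\<close> at most like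
  \<open>s * L * norm p\<close>, so the conjugate would be infinite if \<open>L < norm p\<close>.
  This bounds the dual domains and makes the suprema over them genuine.\<close>

lemma norm_le_lipschitz_of_dual_dom:
  assumes g: "L-lipschitz_on (coord_space J) g" and p: "p \<in> dual_dom J g"
  shows "norm p \<le> L"
proof (rule ccontr)
  assume "\<not> norm p \<le> L"
  then have L: "L < norm p" by simp
  define c where "c = conj_val J g p + g 0"
  have L0: "0 \<le> L" using g lipschitz_on_nonneg by blast
  have pos: "0 < norm p * (norm p - L)" using L L0 by (intro mult_pos_pos) auto
  have *: "s * (norm p * (norm p - L)) \<le> c" if s: "0 < s" for s
  proof -
    have sp: "s *\<^sub>R p \<in> coord_space J"
      using p by (auto simp: dual_dom_def intro: coord_space_closed_ops)
    have "g (s *\<^sub>R p) - g 0 \<le> L * (s * norm p)"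
      using lipschitz_onD[OF g sp coord_space_closed_ops(1)] s by (auto simp: dist_norm)
    moreover have "s * (norm p)\<^sup>2 - conj_val J g p \<le> g (s *\<^sub>R p)"
      using fenchel_inequality[OF p sp] by (simp add: power2_norm_eq_inner)
    ultimately show ?thesis by (simp add: c_def algebra_simps power2_eq_square)
  qed
  define s where "s = (\<bar>c\<bar> + 1) / (norm p * (norm p - L))"
  have "0 < s" using pos by (simp add: s_def)
  moreover have "s * (norm p * (norm p - L)) = \<bar>c\<bar> + 1"
    using pos unfolding s_def by (intro nonzero_eq_divide_eq[THEN iffD1]) auto
  ultimately show False using *[of s] by simp
qed

text \<open>A hyperplane separates \<open>(z, h z)\<close> from the strict epigraph. Its normal
  \<open>(v, s)\<close> has \<open>0 < s\<close>, so it is the graph of an affine minorant of slope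
  \<open>- (v /\<^sub>R s)\<close>.\<close>

lemma convex_on_UNIV_subgradient:
  fixes h :: "'a::euclidean_space \<Rightarrow> real"
  assumes h: "convex_on UNIV h"
  obtains p where "\<And>y. h z + p \<bullet> (y - z) \<le> h y"
proof -
  define S where "S = {(y, t). h y < t}"
  have "convex S"
  proof (unfold convex_def S_def, clarsimp)
    fix y1 t1 y2 t2 and u v :: real
    assume a: "h y1 < t1" "h y2 < t2" "0 \<le> u" "0 \<le> v" "u + v = 1"
    have "h (u *\<^sub>R y1 + v *\<^sub>R y2) \<le> u * h y1 + v * h y2"
      using h a unfolding convex_on_def by auto
    also have "\<dots> < u * t1 + v * t2"
    proof (cases "u = 0")
      case False
      then have "u * h y1 < u * t1" using a by simp
      then show ?thesis using a by (intro add_less_le_mono) (auto intro: mult_left_mono)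
    qed (use a in auto)
    finally show "h (u *\<^sub>R y1 + v *\<^sub>R y2) < u * t1 + v * t2" .
  qed
  moreover have "S \<noteq> {}" by (auto simp: S_def intro: lt_ex gt_ex)
  moreover have "{(z, h z)} \<inter> S = {}" by (auto simp: S_def)
  ultimately obtain a b where ab: "a \<noteq> 0" "\<forall>w\<in>{(z, h z)}. a \<bullet> w \<le> b" "\<forall>w\<in>S. b \<le> a \<bullet> w"
    using separating_hyperplane_sets[of "{(z, h z)}" S] by auto
  obtain v s where a: "a = (v, s)" by (cases a)
  have sep: "v \<bullet> z + s * h z \<le> v \<bullet> y + s * t" if "h y < t" for y t
    using ab(2,3) that unfolding S_def a by force
  have s0: "0 \<le> s" using sep[of z "h z + 1"] by (simp add: algebra_simps)
  \<comment> \<open>Since \<open>h\<close> is finite everywhere, a vertical hyperplane may be tested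
    at \<open>z - v\<close>; this forces \<open>v = 0\<close>, so the whole normal would
    vanish.\<close>
  have "s \<noteq> 0"
  proof
    assume s: "s = 0"
    have "v \<bullet> z \<le> v \<bullet> (z - v)" using sep[of "z - v" "h (z - v) + 1"] s by simp
    then have "v = 0" by (simp add: inner_diff_right flip: power2_norm_eq_inner)
    then show False using ab(1) a s by (simp add: zero_prod_def)
  qed
  with s0 have s: "0 < s" by simp
  have "h z + (- (v /\<^sub>R s)) \<bullet> (y - z) \<le> h y" for y
  proof (rule dense_ge)
    fix t assume "h y < t"
    from sep[OF this] have "s * h z - v \<bullet> (y - z) \<le> s * t" by (simp add: inner_diff_right)
    then show "h z + (- (v /\<^sub>R s)) \<bullet> (y - z) \<le> t" using s by (simp add: field_simps)
  qed
  then show thesis by (rule that)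
qed

text \<open>Convexity of \<open>g\<close> is known on a subspace only, so \<open>g\<close> is
  precomposed with the coordinate projection \<open>P\<close>. A subgradient at \<open>z\<close> is
  projected back; self-adjointness of \<open>P\<close> keeps its pairings with the subspace. At this
  slope the supremum in the conjugate is attained at \<open>z\<close>.\<close>

lemma fenchel_equality:
  assumes g: "convex_on (coord_space J) g" and z: "z \<in> coord_space J"
  obtains p where "p \<in> dual_dom J g" "g z \<le> z \<bullet> p - conj_val J g p"
proof -
  define P :: "real^'a \<Rightarrow> real^'a" where "P y = (\<chi> i. if i \<in> J then y $ i else 0)" for y
  have P: "P y \<in> coord_space J" for y by (simp add: P_def coord_space_def)
  have P_id: "P y = y" if "y \<in> coord_space J" for y
    using that by (auto simp: P_def coord_space_def vec_eq_iff)
  have P_lin: "P (u *\<^sub>R y + v *\<^sub>R w) = u *\<^sub>R P y + v *\<^sub>R P w" for u v y w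
    by (auto simp: P_def vec_eq_iff)
  have P_adj: "y \<bullet> P p = P y \<bullet> p" for y p
    by (auto simp: P_def inner_vec_def intro!: sum.cong)
  have "convex_on UNIV (\<lambda>y. g (P y))"
    using g P unfolding convex_on_def by (auto simp: P_lin)
  then obtain p where p: "\<And>y. g (P z) + p \<bullet> (y - z) \<le> g (P y)"
    using convex_on_UNIV_subgradient by blast
  have "y \<bullet> P p - g y \<le> z \<bullet> P p - g z" if y: "y \<in> coord_space J" for y
    using p[of y] P_id[OF y] P_id[OF z]
    by (simp add: P_adj inner_diff_right inner_commute)
  from conj_val_leI[OF P this] show thesis by (intro that) auto
qed

lemma matrix_vector_in_coord_space:
  assumes "\<And>i. i \<notin> J \<Longrightarrow> T $ i = 0"
  shows "T *v y \<in> coord_space J"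
  using assms by (simp add: coord_space_def matrix_vector_mult_def)

section \<open>Relative entropy\<close>

text \<open>The pointwise core of Pinsker's inequality: \<open>F\<close> and \<open>F'\<close>
  vanish at 1, and \<open>F''\<close> is nonnegative by the tangent bound of the logarithm at
  \<open>1 / y\<close>, so \<open>F\<close> has its minimum at 1.\<close>

lemma pinsker_scalar:
  fixes x :: real
  assumes "0 < x"
  shows "3 * (x - 1)\<^sup>2 \<le> (4 + 2 * x) * (x * ln x - x + 1)"
proof -
  define F where "F y = (4 + 2 * y) * (y * ln y - y + 1) - 3 * (y - 1)\<^sup>2" for y :: real
  define F' where "F' y = 4 * ((y + 1) * ln y - 2 * (y - 1))" for y :: real
  define F'' where "F'' y = 4 * (ln y + 1 / y - 1)" for y :: real
  have d1: "(F has_real_derivative F' y) (at y)" if "0 < y" for y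
    unfolding F_def F'_def using that
    by (auto intro!: derivative_eq_intros simp: field_simps power2_eq_square)
  have d2: "(F' has_real_derivative F'' y) (at y)" if "0 < y" for y
    unfolding F'_def F''_def using that
    by (auto intro!: derivative_eq_intros simp: field_simps)
  have F'': "0 \<le> F'' y" if "0 < y" for y
    using ln_le_minus_one[of "1 / y"] that by (simp add: F''_def ln_div)
  have F'_mono: "F' y \<le> F' z" if "0 < y" "y \<le> z" for y z
    using that by (intro DERIV_nonneg_imp_nondecreasing[of y z F']) (auto intro!: exI d2 F'')
  have F'1: "F' 1 = 0" by (simp add: F'_def)
  have "F 1 \<le> F x"
  proof (cases "1 \<le> x")
    case True
    then show ?thesis
      using F'_mono[of 1] F'1
      by (intro DERIV_nonneg_imp_nondecreasing[of 1 x F]) (auto intro!: exI d1)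
  next
    case False
    then show ?thesis
      using F'_mono[of _ 1] F'1 assms
      by (intro DERIV_nonpos_imp_nonincreasing[of x 1 F]) (fastforce intro!: exI d1)+
  qed
  then show ?thesis by (simp add: F_def)
qed

text \<open>The scalar inequality at \<open>b / a\<close>, scaled by \<open>a\<^sup>2\<close>,
  covers positive entries; when \<open>b = 0\<close> the logarithmic term drops out. The second
  claim provides the sign that Cauchy-Schwarz needs.\<close>

lemma pinsker_pair:
  fixes a b :: real
  assumes "0 \<le> a" "0 \<le> b" "a = 0 \<Longrightarrow> b = 0"
  shows "(b - a)\<^sup>2 \<le> (4 * a + 2 * b) / 3 * (b * ln (b / a) - b + a)"
    and "0 \<le> b * ln (b / a) - b + a"
proof -
  have "(b - a)\<^sup>2 \<le> (4 * a + 2 * b) / 3 * (b * ln (b / a) - b + a) \<and> 0 \<le> b * ln (b / a) - b + a"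
  proof (cases "a = 0 \<or> b = 0")
    case True
    then show ?thesis using assms by (auto simp: power2_eq_square)
  next
    case False
    then have ab: "0 < a" "0 < b" using assms by auto
    have "3 * (b / a - 1)\<^sup>2 \<le> (4 + 2 * (b / a)) * (b / a * ln (b / a) - b / a + 1)"
      using ab by (intro pinsker_scalar) simp
    then have "a\<^sup>2 * (3 * (b / a - 1)\<^sup>2)
        \<le> a\<^sup>2 * ((4 + 2 * (b / a)) * (b / a * ln (b / a) - b / a + 1))"
      by (intro mult_left_mono) auto
    also have "a\<^sup>2 * (3 * (b / a - 1)\<^sup>2) = 3 * (b - a)\<^sup>2"
      using ab by (simp add: field_simps power2_eq_square)
    also have "a\<^sup>2 * ((4 + 2 * (b / a)) * (b / a * ln (b / a) - b / a + 1))
        = (4 * a + 2 * b) * (b * ln (b / a) - b + a)"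
      using ab by (simp add: field_simps power2_eq_square)
    finally have 1: "3 * (b - a)\<^sup>2 \<le> (4 * a + 2 * b) * (b * ln (b / a) - b + a)" .
    have "- ln (b / a) \<le> a / b - 1"
      using ln_le_minus_one[of "a / b"] ab by (simp add: ln_div)
    then have "b * (- ln (b / a)) \<le> b * (a / b - 1)" using ab by (intro mult_left_mono) auto
    then have "0 \<le> b * ln (b / a) - b + a" using ab by (simp add: right_diff_distrib)
    then show ?thesis using 1 by simp
  qed
  then show "(b - a)\<^sup>2 \<le> (4 * a + 2 * b) / 3 * (b * ln (b / a) - b + a)"
    "0 \<le> b * ln (b / a) - b + a" by auto
qed

lemma sum_squared_le_prod_sums:
  fixes d u v :: "'i \<Rightarrow> real"
  assumes "\<And>i. i \<in> S \<Longrightarrow> (d i)\<^sup>2 \<le> u i * v i" "\<And>i. i \<in> S \<Longrightarrow> 0 \<le> u i" "\<And>i. i \<in> S \<Longrightarrow> 0 \<le> v i"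
  shows "(\<Sum>i\<in>S. \<bar>d i\<bar>)\<^sup>2 \<le> (\<Sum>i\<in>S. u i) * (\<Sum>i\<in>S. v i)"
proof -
  have "\<bar>d i\<bar> \<le> sqrt (u i) * sqrt (v i)" if "i \<in> S" for i
    using assms(1)[OF that] by (metis real_sqrt_abs real_sqrt_le_mono real_sqrt_mult)
  then have "(\<Sum>i\<in>S. \<bar>d i\<bar>)\<^sup>2 \<le> (\<Sum>i\<in>S. sqrt (u i) * sqrt (v i))\<^sup>2"
    by (intro power_mono sum_mono) (auto intro: sum_nonneg)
  also have "\<dots> \<le> (\<Sum>i\<in>S. (sqrt (u i))\<^sup>2) * (\<Sum>i\<in>S. (sqrt (v i))\<^sup>2)"
    by (rule Cauchy_Schwarz_ineq_sum)
  finally show ?thesis using assms by simp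
qed

text \<open>Cauchy-Schwarz sums the pairwise bounds. Equal masses turn the first factor into
  \<open>(4 * m + 2 * m) / 3\<close> and cancel the linear terms of the second.\<close>

lemma pinsker:
  fixes a b :: "'i \<Rightarrow> real"
  assumes ab: "\<And>i. i \<in> S \<Longrightarrow> 0 \<le> a i" "\<And>i. i \<in> S \<Longrightarrow> 0 \<le> b i"
      "\<And>i. i \<in> S \<Longrightarrow> a i = 0 \<Longrightarrow> b i = 0"
    and m: "sum a S = m" "sum b S = m"
  shows "(\<Sum>i\<in>S. \<bar>b i - a i\<bar>)\<^sup>2 \<le> 2 * m * (\<Sum>i\<in>S. b i * ln (b i / a i))"
proof -
  have "(\<Sum>i\<in>S. \<bar>b i - a i\<bar>)\<^sup>2
      \<le> (\<Sum>i\<in>S. (4 * a i + 2 * b i) / 3) * (\<Sum>i\<in>S. b i * ln (b i / a i) - b i + a i)"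
    using ab by (intro sum_squared_le_prod_sums pinsker_pair) auto
  also have "(\<Sum>i\<in>S. (4 * a i + 2 * b i) / 3) = 2 * m"
    using m by (simp add: sum.distrib flip: sum_divide_distrib sum_distrib_left)
  also have "(\<Sum>i\<in>S. b i * ln (b i / a i) - b i + a i) = (\<Sum>i\<in>S. b i * ln (b i / a i))"
    using m by (simp add: sum.distrib sum_subtractf)
  finally show ?thesis .
qed

text \<open>Moving from \<open>h\<close> towards \<open>g\<close>, the gradient inequality at the moved point \<open>h + s (g - h)\<close>
  bounds the change of the objective; the slope is monotone in \<open>s\<close>, and it would tend to
  \<open>-\<infinity>\<close> as \<open>s\<close> tends to \<open>0\<close> if \<open>g\<close> charged an index that \<open>h\<close> does not.\<close>

lemma entropy_prox:
  fixes a c g h :: "'i \<Rightarrow> real"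
  assumes fin: "finite S"
    and a: "\<And>i. i \<in> S \<Longrightarrow> 0 < a i" and g: "\<And>i. i \<in> S \<Longrightarrow> 0 \<le> g i"
    and h: "\<And>i. i \<in> S \<Longrightarrow> 0 \<le> h i" and eq: "sum g S = sum h S" and \<tau>: "0 < \<tau>"
    and max: "\<And>s. 0 < s \<Longrightarrow> s < 1 \<Longrightarrow>
      (\<Sum>i\<in>S. c i * (h i + s * (g i - h i)))
        - \<tau> * (\<Sum>i\<in>S. (h i + s * (g i - h i)) * ln ((h i + s * (g i - h i)) / a i))
      \<le> (\<Sum>i\<in>S. c i * h i) - \<tau> * (\<Sum>i\<in>S. h i * ln (h i / a i))"
  shows "\<And>i. i \<in> S \<Longrightarrow> h i = 0 \<Longrightarrow> g i = 0"
    and "(\<Sum>i\<in>S. c i * g i) + \<tau> * (\<Sum>i\<in>S. h i * ln (h i / a i)) + \<tau> * (\<Sum>i\<in>S. g i * ln (g i / h i))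
      \<le> (\<Sum>i\<in>S. c i * h i) + \<tau> * (\<Sum>i\<in>S. g i * ln (g i / a i))"
proof -
  define w where "w s i = h i + s * (g i - h i)" for s i
  define B where "B = (\<Sum>i\<in>S. c i * (g i - h i))"
  have w_pos: "0 < w s i" if "i \<in> S" "0 < s" "s < 1" "\<not> (g i = 0 \<and> h i = 0)" for s i
  proof -
    have "w s i = (1 - s) * h i + s * g i" by (simp add: w_def algebra_simps)
    moreover have "0 < (1 - s) * h i + s * g i"
    proof (cases "h i = 0")
      case True
      then show ?thesis using that g[OF that(1)] by simp
    next
      case False
      then have "0 < (1 - s) * h i" "0 \<le> s * g i" using that g[OF that(1)] h[OF that(1)] by auto
      then show ?thesis by linarith
    qed
    ultimately show ?thesis by simp
  qed
  have slope: "B \<le> \<tau> * (\<Sum>i\<in>S. (g i - h i) * ln (w s i / a i))" if s: "0 < s" "s < 1" for s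
  proof -
    \<comment> \<open>The gradient inequality for the convex function
      \<open>t * ln (t / a i)\<close>, whose derivative at \<open>w s i\<close> is
      \<open>ln (w s i / a i) + 1\<close>.\<close>
    have pt: "w s i * ln (w s i / a i) - h i * ln (h i / a i) \<le> s * (g i - h i) * (ln (w s i / a i) + 1)"
      if i: "i \<in> S" for i
    proof (cases "g i = 0 \<and> h i = 0")
      case True
      then show ?thesis by (simp add: w_def)
    next
      case False
      note wp = w_pos[OF i s False]
      show ?thesis
      proof (cases "h i = 0")
        case True
        then show ?thesis using g[OF i] s by (simp add: w_def algebra_simps)
      next
        case False
        then have hp: "0 < h i" using h[OF i] by simp
        have "h i * (ln (w s i / a i) - ln (h i / a i)) = h i * ln (w s i / h i)"
          using hp wp a[OF i] by (simp add: ln_div)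
        also have "\<dots> \<le> h i * (w s i / h i - 1)"
          using hp wp by (intro mult_left_mono ln_le_minus_one) auto
        also have "\<dots> = w s i - h i" using hp by (simp add: field_simps)
        finally have "h i * (ln (w s i / a i) - ln (h i / a i)) \<le> s * (g i - h i)"
          by (simp add: w_def)
        moreover have "w s i * ln (w s i / a i)
            = h i * ln (w s i / a i) + s * (g i - h i) * ln (w s i / a i)"
          by (simp add: w_def algebra_simps)
        ultimately show ?thesis by (simp add: algebra_simps)
      qed
    qed
    have "s * B = (\<Sum>i\<in>S. c i * w s i) - (\<Sum>i\<in>S. c i * h i)"
      unfolding B_def sum_distrib_left sum_subtractf[symmetric]
      by (rule sum.cong) (auto simp: w_def algebra_simps)
    also have "\<dots> \<le> \<tau> * (\<Sum>i\<in>S. w s i * ln (w s i / a i) - h i * ln (h i / a i))"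
      using max[OF s] unfolding w_def sum_subtractf right_diff_distrib by linarith
    also have "\<dots> \<le> \<tau> * (\<Sum>i\<in>S. s * (g i - h i) * (ln (w s i / a i) + 1))"
      using \<tau> by (intro mult_left_mono sum_mono pt) auto
    also have "(\<Sum>i\<in>S. s * (g i - h i) * (ln (w s i / a i) + 1))
        = s * ((\<Sum>i\<in>S. (g i - h i) * ln (w s i / a i)) + (\<Sum>i\<in>S. g i - h i))"
      unfolding sum_distrib_left sum.distrib[symmetric]
      by (rule sum.cong) (auto simp: algebra_simps)
    \<comment> \<open>Equal total masses remove the constant \<open>1\<close> of the
      derivative.\<close>
    also have "(\<Sum>i\<in>S. g i - h i) = 0" using eq by (simp add: sum_subtractf)
    finally have "s * B \<le> s * (\<tau> * (\<Sum>i\<in>S. (g i - h i) * ln (w s i / a i)))"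
      by (simp add: mult_ac)
    then show ?thesis using s by simp
  qed
  have supp: "g j = 0" if j: "j \<in> S" "h j = 0" for j
  proof (rule ccontr)
    assume "g j \<noteq> 0"
    then have gj: "0 < g j" using g[OF j(1)] by simp
    \<comment> \<open>Each \<open>(g i - h i) * ln (w s i / a i)\<close> is nondecreasing in
      \<open>s\<close>, so its value at \<open>1/2\<close>, a fixed point of the open interval,
      bounds it for all smaller \<open>s\<close>. Only the term of \<open>j\<close> is left, where
      \<open>w s j = s * g j\<close>.\<close>
    define R where "R = (\<Sum>i\<in>S - {j}. (g i - h i) * ln (w (1/2) i / a i))"
    have bnd: "B / \<tau> - R \<le> g j * ln (s * g j / a j)" if s: "0 < s" "s \<le> 1/2" for s
    proof -
      have "B / \<tau> \<le> (\<Sum>i\<in>S. (g i - h i) * ln (w s i / a i))"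
        using slope[of s] s \<tau> by (simp add: field_simps)
      also have "\<dots> = g j * ln (s * g j / a j) + (\<Sum>i\<in>S - {j}. (g i - h i) * ln (w s i / a i))"
        using j fin by (subst sum.remove[of _ j]) (auto simp: w_def)
      also have "(\<Sum>i\<in>S - {j}. (g i - h i) * ln (w s i / a i)) \<le> R"
        unfolding R_def
      proof (rule sum_mono)
        fix i assume "i \<in> S - {j}"
        then have i: "i \<in> S" by simp
        show "(g i - h i) * ln (w s i / a i) \<le> (g i - h i) * ln (w (1/2) i / a i)"
        proof (cases "g i = 0 \<and> h i = 0")
          case False
          have wp: "0 < w s i" "0 < w (1/2) i" using w_pos[OF i _ _ False] s by auto
          consider "h i \<le> g i" | "g i \<le> h i" by linarith
          then show ?thesis
          proof cases
            case 1
            then have "w s i \<le> w (1/2) i"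
              unfolding w_def using s by (intro add_left_mono mult_right_mono) auto
            then show ?thesis using 1 wp a[OF i] by (intro mult_left_mono) (auto simp: divide_right_mono)
          next
            case 2
            then have "w (1/2) i \<le> w s i"
              unfolding w_def using s by (intro add_left_mono mult_right_mono_neg) auto
            then show ?thesis using 2 wp a[OF i] by (intro mult_left_mono_neg) (auto simp: divide_right_mono)
          qed
        qed simp
      qed
      finally show ?thesis by simp
    qed
    \<comment> \<open>The term of \<open>j\<close> tends to -\<infinity> as \<open>s\<close>
      decreases to 0 and so falls below the fixed lower bound \<open>B / \<tau> - R\<close>.\<close>
    have "filterlim (\<lambda>s. g j * ln (s * (g j / a j))) at_bot (at_right 0)"
    proof -
      have "filterlim (\<lambda>s. s * (g j / a j)) (at_right 0) (at_right 0)"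
        using filterlim_times_pos[of "\<lambda>s::real. s" 0 "at_right 0" "g j / a j" 0] gj a[OF j(1)]
        by (simp add: mult.commute filterlim_ident)
      then have "filterlim (\<lambda>s. ln (s * (g j / a j))) at_bot (at_right 0)"
        by (rule filterlim_compose[OF ln_at_0])
      then show ?thesis
        using gj by (intro filterlim_tendsto_pos_mult_at_bot[OF tendsto_const])
    qed
    then have "\<forall>\<^sub>F s in at_right 0. g j * ln (s * (g j / a j)) < B / \<tau> - R"
      by (auto simp: filterlim_at_bot_dense)
    moreover have "\<forall>\<^sub>F s in at_right (0::real). s \<in> {0<..<1/2}"
      by (rule eventually_at_right_real) simp
    ultimately have "\<forall>\<^sub>F s in at_right (0::real). False"
      by eventually_elim (use bnd in fastforce)
    then show False by simp
  qed
  then show "\<And>i. i \<in> S \<Longrightarrow> h i = 0 \<Longrightarrow> g i = 0" .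
  \<comment> \<open>With the supports settled, \<open>s\<close> may tend to 0 in
    \<open>slope\<close>: terms with \<open>h i = 0\<close> are identically zero, the others are
    continuous.\<close>
  have "((\<lambda>s. \<tau> * (\<Sum>i\<in>S. (g i - h i) * ln (w s i / a i)))
      \<longlongrightarrow> \<tau> * (\<Sum>i\<in>S. (g i - h i) * ln (h i / a i))) (at_right 0)"
  proof (rule tendsto_mult[OF tendsto_const tendsto_sum])
    fix i assume i: "i \<in> S"
    show "((\<lambda>s. (g i - h i) * ln (w s i / a i)) \<longlongrightarrow> (g i - h i) * ln (h i / a i)) (at_right 0)"
    proof (cases "h i = 0")
      case True
      then show ?thesis using supp[OF i] by simp
    next
      case False
      have "((\<lambda>s. w s i) \<longlongrightarrow> h i + 0 * (g i - h i)) (at_right 0)"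
        unfolding w_def by (intro tendsto_intros)
      then show ?thesis using False a[OF i] h[OF i] by (intro tendsto_intros) auto
    qed
  qed
  moreover have "\<forall>\<^sub>F s in at_right (0::real). B \<le> \<tau> * (\<Sum>i\<in>S. (g i - h i) * ln (w s i / a i))"
    using eventually_at_right_real[of 0 "1::real"] by (auto elim!: eventually_mono intro: slope)
  ultimately have "B \<le> \<tau> * (\<Sum>i\<in>S. (g i - h i) * ln (h i / a i))"
    by (intro tendsto_lowerbound[where F = "at_right (0::real)"]) auto
  \<comment> \<open>The three-point identity of relative entropy; by \<open>supp\<close>,
    \<open>h i\<close> is positive wherever \<open>g i\<close> is.\<close>
  also have "(\<Sum>i\<in>S. (g i - h i) * ln (h i / a i))
      = (\<Sum>i\<in>S. g i * ln (g i / a i) - g i * ln (g i / h i) - h i * ln (h i / a i))"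
  proof (rule sum.cong[OF refl])
    fix i assume i: "i \<in> S"
    show "(g i - h i) * ln (h i / a i)
        = g i * ln (g i / a i) - g i * ln (g i / h i) - h i * ln (h i / a i)"
    proof (cases "g i = 0")
      case False
      then have "0 < g i" "0 < h i" "0 < a i"
        using g[OF i] h[OF i] a[OF i] supp[OF i] by (auto simp: order_less_le)
      then show ?thesis by (simp add: ln_div algebra_simps)
    qed simp
  qed
  finally show "(\<Sum>i\<in>S. c i * g i) + \<tau> * (\<Sum>i\<in>S. h i * ln (h i / a i)) + \<tau> * (\<Sum>i\<in>S. g i * ln (g i / h i))
      \<le> (\<Sum>i\<in>S. c i * h i) + \<tau> * (\<Sum>i\<in>S. g i * ln (g i / a i))"
    by (simp add: B_def sum_subtractf right_diff_distrib)
qed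

section \<open>Transport plans\<close>

lemma transport_plansD:
  fixes G :: "real^'k^'k::finite"
  assumes "G \<in> transport_plans D \<delta>"
  shows "0 \<le> G $ i $ j" "(\<Sum>j\<in>UNIV. G $ i $ j) = 1 / real CARD('k)"
  using assms by (auto simp: transport_plans_def)

lemma sum_entries_eq_1:
  fixes G :: "real^'k^'k::finite"
  assumes "\<And>i. (\<Sum>j\<in>UNIV. G $ i $ j) = 1 / real CARD('k)"
  shows "(\<Sum>(i, j)\<in>UNIV. G $ i $ j) = 1"
  using assms by (simp add: UNIV_Times_UNIV[symmetric] sum.cartesian_product[symmetric] del: UNIV_Times_UNIV)

lemma transport_plans_le_1:
  fixes G :: "real^'k^'k::finite"
  assumes "G \<in> transport_plans D \<delta>"
  shows "G $ i $ j \<le> 1"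
proof -
  have "G $ i $ j \<le> (\<Sum>j\<in>UNIV. G $ i $ j)"
    using transport_plansD(1)[OF assms] by (intro member_le_sum) auto
  also have "\<dots> \<le> 1" using transport_plansD(2)[OF assms] by (simp add: divide_le_eq_1)
  finally show ?thesis .
qed

lemma convex_transport_plans: "convex (transport_plans D \<delta>)"
proof -
  have "u *\<^sub>R F + v *\<^sub>R G \<in> transport_plans D \<delta>"
    if FG: "F \<in> transport_plans D \<delta>" "G \<in> transport_plans D \<delta>"
      and uv: "0 \<le> u" "0 \<le> v" "u + v = 1" for F G u v
  proof -
    have "(\<Sum>i\<in>UNIV. \<Sum>j\<in>UNIV. D $ i $ j * (u *\<^sub>R F + v *\<^sub>R G) $ i $ j)
        = u * (\<Sum>i\<in>UNIV. \<Sum>j\<in>UNIV. D $ i $ j * F $ i $ j)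
        + v * (\<Sum>i\<in>UNIV. \<Sum>j\<in>UNIV. D $ i $ j * G $ i $ j)"
      by (simp add: sum_distrib_left flip: sum.distrib) (simp add: algebra_simps)
    also have "\<dots> \<le> u * \<delta> + v * \<delta>"
      using FG uv by (intro add_mono mult_left_mono) (auto simp: transport_plans_def)
    also have "\<dots> = \<delta>" using uv by (metis distrib_right mult_1)
    finally show ?thesis
      using FG uv unfolding transport_plans_def
      by (auto simp: sum.distrib simp flip: sum_distrib_left add_divide_distrib)
  qed
  then show ?thesis by (simp add: convex_def)
qed

lemma col_sums_nth: "col_sums H $ j = (\<Sum>i\<in>UNIV. H $ i $ j)"
  by (simp add: col_sums_def)

lemma col_sums_inner:
  "col_sums H \<bullet> v = (\<Sum>(i, j)\<in>UNIV. v $ j * H $ i $ j)"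
  unfolding UNIV_Times_UNIV[symmetric] sum.cartesian_product[symmetric]
  by (subst sum.swap) (simp add: inner_vec_def col_sums_nth sum_distrib_left mult.commute)

lemma col_sums_nonneg:
  assumes "G \<in> transport_plans D \<delta>"
  shows "0 \<le> col_sums G $ k"
  using transport_plansD(1)[OF assms] by (auto simp: col_sums_nth intro: sum_nonneg)

lemma sum_col_sums:
  fixes G :: "real^'k^'k::finite"
  assumes "G \<in> transport_plans D \<delta>"
  shows "(\<Sum>k\<in>UNIV. col_sums G $ k) = 1"
  unfolding col_sums_nth by (subst sum.swap) (simp add: transport_plansD(2)[OF assms])

lemma l1_col_sums_le:
  "(\<Sum>k\<in>UNIV. \<bar>col_sums G $ k - col_sums H $ k\<bar>) \<le> (\<Sum>(i, j)\<in>UNIV. \<bar>G $ i $ j - H $ i $ j\<bar>)"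
proof -
  have "(\<Sum>k\<in>UNIV. \<bar>col_sums G $ k - col_sums H $ k\<bar>) \<le> (\<Sum>k\<in>UNIV. \<Sum>i\<in>UNIV. \<bar>G $ i $ k - H $ i $ k\<bar>)"
    unfolding col_sums_nth sum_subtractf[symmetric] by (intro sum_mono sum_abs)
  then show ?thesis
    unfolding UNIV_Times_UNIV[symmetric] sum.cartesian_product[symmetric] by (subst sum.swap)
qed

section \<open>The two distances between plans: strong convexity, proximal steps,
  boundedness\<close>

lemma mat_dist_Entropy:
  "mat_dist Entropy H G = (\<Sum>(i, j)\<in>UNIV. G $ i $ j * ln (G $ i $ j / H $ i $ j))"
  unfolding UNIV_Times_UNIV[symmetric] sum.cartesian_product[symmetric] by (simp add: mat_dist_def)

text \<open>This form makes \<open>half_sq_dist_prox\<close> applicable to the whole matrix at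
  once.\<close>

lemma mat_dist_Euclidean_half_sq: "mat_dist Euclidean H G = half_sq_dist H G"
  by (simp add: mat_dist_def half_sq_dist_def norm_vec_def[of "H - G"] L2_set_def
      sum_nonneg flip: sum_divide_distrib)

lemma mat_dist_Euclidean:
  "mat_dist Euclidean H G = (\<Sum>(i, j)\<in>UNIV. (G $ i $ j - H $ i $ j)\<^sup>2) / 2"
  unfolding UNIV_Times_UNIV[symmetric] sum.cartesian_product[symmetric]
  by (simp add: mat_dist_def half_sq_dist_def norm_vec_def L2_set_def
      sum_nonneg power2_commute flip: sum_divide_distrib)

lemma mat_dist_Euclidean_strong:
  fixes G H :: "real^'k^'k::finite"
  shows "(\<Sum>k\<in>UNIV. \<bar>col_sums G $ k - col_sums H $ k\<bar>)\<^sup>2 \<le> 2 * (real CARD('k))\<^sup>2 * mat_dist Euclidean H G"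
proof -
  have "(\<Sum>k\<in>UNIV. \<bar>col_sums G $ k - col_sums H $ k\<bar>)\<^sup>2
      \<le> (\<Sum>p\<in>UNIV. \<bar>case p of (i, j) \<Rightarrow> G $ i $ j - H $ i $ j\<bar>)\<^sup>2"
    using l1_col_sums_le[of G H] by (intro power_mono) (auto simp: case_prod_unfold intro: sum_nonneg)
  also have "\<dots> \<le> (\<Sum>p\<in>(UNIV :: ('k \<times> 'k) set). 1)
      * (\<Sum>p\<in>UNIV. (case p of (i, j) \<Rightarrow> G $ i $ j - H $ i $ j)\<^sup>2)"
    by (rule sum_squared_le_prod_sums) auto
  also have "\<dots> = 2 * (real CARD('k))\<^sup>2 * mat_dist Euclidean H G"
    by (simp add: mat_dist_Euclidean case_prod_unfold power2_eq_square)
  finally show ?thesis .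
qed

text \<open>The entries form two distributions of mass 1 on pairs of indices, so
  \<open>pinsker\<close> applies with \<open>m = 1\<close>. Only row sums are prescribed, which
  admits the starting matrix as \<open>H\<close>.\<close>

lemma mat_dist_Entropy_strong:
  fixes G H :: "real^'k^'k::finite"
  assumes G: "\<And>i j. 0 \<le> G $ i $ j" "\<And>i. (\<Sum>j\<in>UNIV. G $ i $ j) = 1 / real CARD('k)"
    and H: "\<And>i j. 0 \<le> H $ i $ j" "\<And>i. (\<Sum>j\<in>UNIV. H $ i $ j) = 1 / real CARD('k)"
    and supp: "\<And>i j. H $ i $ j = 0 \<Longrightarrow> G $ i $ j = 0"
  shows "(\<Sum>k\<in>UNIV. \<bar>col_sums G $ k - col_sums H $ k\<bar>)\<^sup>2 \<le> 2 * mat_dist Entropy H G"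
proof -
  have "(\<Sum>k\<in>UNIV. \<bar>col_sums G $ k - col_sums H $ k\<bar>)\<^sup>2
      \<le> (\<Sum>p\<in>UNIV. \<bar>G $ fst p $ snd p - H $ fst p $ snd p\<bar>)\<^sup>2"
    using l1_col_sums_le[of G H] by (intro power_mono) (auto simp: case_prod_unfold intro: sum_nonneg)
  also have "\<dots> \<le> 2 * 1 * (\<Sum>p\<in>UNIV. G $ fst p $ snd p * ln (G $ fst p $ snd p / H $ fst p $ snd p))"
    using sum_entries_eq_1[OF G(2)] sum_entries_eq_1[OF H(2)] G H supp
    by (intro pinsker) (auto simp: case_prod_unfold)
  finally show ?thesis by (simp add: mat_dist_Entropy case_prod_unfold)
qed

lemma mat_dist_Euclidean_prox:
  assumes max: "is_arg_max (\<lambda>G. col_sums G \<bullet> v - \<tau> * mat_dist Euclidean A G)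
      (\<lambda>G. G \<in> transport_plans D \<delta>) H"
    and G: "G \<in> transport_plans D \<delta>"
  shows "col_sums G \<bullet> v + \<tau> * mat_dist Euclidean A H + \<tau> * mat_dist Euclidean H G
    \<le> col_sums H \<bullet> v + \<tau> * mat_dist Euclidean A G"
proof -
  have "convex_on (transport_plans D \<delta>) (\<lambda>G. - (col_sums G \<bullet> v))"
    unfolding convex_on_def
    by (auto simp: convex_transport_plans col_sums_def sum.distrib inner_add_left
        simp flip: scaleR_sum_right)
  then have "- (col_sums H \<bullet> v) + \<tau> * half_sq_dist A H + \<tau> * half_sq_dist H G
      \<le> - (col_sums G \<bullet> v) + \<tau> * half_sq_dist A G"
    using max G
    by (intro half_sq_dist_prox[where S = "transport_plans D \<delta>"])
      (auto simp: is_arg_max_linorder mat_dist_Euclidean_half_sq)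
  then show ?thesis by (simp add: mat_dist_Euclidean_half_sq)
qed

text \<open>Optimality is used along the segment from \<open>H\<close> to \<open>G\<close>, which
  stays among the plans by convexity; this is the situation of \<open>entropy_prox\<close> over
  pairs of indices. The support claim supplies the hypothesis of
  \<open>mat_dist_Entropy_strong\<close> at an iterate whose positivity is not given.\<close>

lemma mat_dist_Entropy_prox:
  assumes max: "is_arg_max (\<lambda>G. col_sums G \<bullet> v - \<tau> * mat_dist Entropy A G)
      (\<lambda>G. G \<in> transport_plans D \<delta>) H"
    and G: "G \<in> transport_plans D \<delta>" and A: "\<And>i j. 0 < A $ i $ j" and \<tau>: "0 < \<tau>"
  shows "\<And>i j. H $ i $ j = 0 \<Longrightarrow> G $ i $ j = 0"
    and "col_sums G \<bullet> v + \<tau> * mat_dist Entropy A H + \<tau> * mat_dist Entropy H G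
    \<le> col_sums H \<bullet> v + \<tau> * mat_dist Entropy A G"
proof -
  have H: "H \<in> transport_plans D \<delta>" using max by (simp add: is_arg_max_def)
  have line: "(\<Sum>p\<in>UNIV. v $ snd p * (H $ fst p $ snd p + s * (G $ fst p $ snd p - H $ fst p $ snd p)))
        - \<tau> * (\<Sum>p\<in>UNIV. (H $ fst p $ snd p + s * (G $ fst p $ snd p - H $ fst p $ snd p))
            * ln ((H $ fst p $ snd p + s * (G $ fst p $ snd p - H $ fst p $ snd p)) / A $ fst p $ snd p))
      \<le> (\<Sum>p\<in>UNIV. v $ snd p * H $ fst p $ snd p)
        - \<tau> * (\<Sum>p\<in>UNIV. H $ fst p $ snd p * ln (H $ fst p $ snd p / A $ fst p $ snd p))"
    if s: "0 < s" "s < 1" for s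
  proof -
    define F where "F = (1 - s) *\<^sub>R H + s *\<^sub>R G"
    have F: "F \<in> transport_plans D \<delta>"
      unfolding F_def using convex_transport_plans H G s by (intro convexD) auto
    have nth: "F $ i $ j = H $ i $ j + s * (G $ i $ j - H $ i $ j)" for i j
      by (simp add: F_def algebra_simps)
    have "col_sums F \<bullet> v - \<tau> * mat_dist Entropy A F \<le> col_sums H \<bullet> v - \<tau> * mat_dist Entropy A H"
      using max F by (auto simp: is_arg_max_linorder)
    then show ?thesis
      unfolding col_sums_inner mat_dist_Entropy case_prod_unfold nth .
  qed
  have sums: "(\<Sum>p\<in>UNIV. G $ fst p $ snd p) = (\<Sum>p\<in>UNIV. H $ fst p $ snd p)"
    using sum_entries_eq_1[OF transport_plansD(2)[OF G]] sum_entries_eq_1[OF transport_plansD(2)[OF H]]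
    by (simp add: case_prod_unfold)
  note prox = entropy_prox[where S = UNIV and a = "\<lambda>p. A $ fst p $ snd p" and g = "\<lambda>p. G $ fst p $ snd p"
      and h = "\<lambda>p. H $ fst p $ snd p" and c = "\<lambda>p. v $ snd p", OF finite A transport_plansD(1)[OF G]
      transport_plansD(1)[OF H] sums \<tau> line]
  show "G $ i $ j = 0" if "H $ i $ j = 0" for i j
    using prox(1)[of "(i, j)"] that by simp
  show "col_sums G \<bullet> v + \<tau> * mat_dist Entropy A H + \<tau> * mat_dist Entropy H G
    \<le> col_sums H \<bullet> v + \<tau> * mat_dist Entropy A G"
    using prox(2) unfolding col_sums_inner mat_dist_Entropy case_prod_unfold .
qed

text \<open>This makes the supremum in \<open>\<Omega>\<^sub>H\<close> genuine. Entries of plans lie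
  between 0 and 1, and \<open>1 / a\<close> bounds the contribution of an entry for either
  distance.\<close>

lemma bdd_above_mat_dist:
  fixes D :: "real^'k^'k::finite"
  shows "bdd_above ((\<lambda>G. mat_dist W (\<chi> i j. 1 / (real CARD('k))\<^sup>2) G) ` transport_plans D \<delta>)"
proof -
  define a where "a = 1 / (real CARD('k))\<^sup>2"
  have a: "0 < a" "a \<le> 1" by (auto simp: a_def divide_le_eq_1)
  have "mat_dist W (\<chi> i j. a) G \<le> (\<Sum>(i, j)\<in>(UNIV :: ('k \<times> 'k) set). 1 / a)"
    if G: "G \<in> transport_plans D \<delta>" for G
  proof -
    have G': "0 \<le> G $ i $ j" "G $ i $ j \<le> 1" for i j
      using transport_plansD(1)[OF G] transport_plans_le_1[OF G] by auto
    show ?thesis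
    proof (cases W)
      case Entropy
      have "G $ i $ j * ln (G $ i $ j / a) \<le> 1 / a" for i j
      proof (cases "G $ i $ j = 0")
        case False
        then have pos: "0 < G $ i $ j" using G'[of i j] by simp
        have "ln (G $ i $ j / a) \<le> G $ i $ j / a" using pos a by (intro ln_bound) auto
        also have "\<dots> \<le> 1 / a" using G' a by (intro divide_right_mono) auto
        finally have "G $ i $ j * ln (G $ i $ j / a) \<le> 1 * (1 / a)"
          using G'[of i j] a mult_left_mono[of "ln (G $ i $ j / a)" "1 / a" "G $ i $ j"]
            mult_right_mono[of "G $ i $ j" 1 "1 / a"] by auto
        then show ?thesis by simp
      qed (use a in simp)
      then show ?thesis
        unfolding Entropy mat_dist_Entropy by (intro sum_mono) (auto simp: case_prod_unfold)
    next
      case Euclidean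
      have "(G $ i $ j - a)\<^sup>2 \<le> 1 / a" for i j
      proof -
        have "\<bar>G $ i $ j - a\<bar> \<le> 1" using G'[of i j] a by auto
        then have "(G $ i $ j - a)\<^sup>2 \<le> 1" by (simp add: abs_square_le_1)
        also have "1 \<le> 1 / a" using a by simp
        finally show ?thesis .
      qed
      then have "(\<Sum>(i, j)\<in>UNIV. (G $ i $ j - a)\<^sup>2) \<le> (\<Sum>(i, j)\<in>(UNIV :: ('k \<times> 'k) set). 1 / a)"
        by (intro sum_mono) (auto simp: case_prod_unfold)
      moreover have "0 \<le> (\<Sum>(i, j)\<in>UNIV. (G $ i $ j - a)\<^sup>2)"
        by (intro sum_nonneg) auto
      ultimately show ?thesis
        unfolding Euclidean mat_dist_Euclidean by (simp only: vec_lambda_beta)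
    qed
  qed
  then show ?thesis unfolding a_def[symmetric] by (rule bdd_aboveI2)
qed

section \<open>The gap estimate\<close>

definition lagrangian ::
  "(real^'n \<Rightarrow> real) \<Rightarrow> ('k::finite \<Rightarrow> 'm::finite set) \<Rightarrow> ('k \<Rightarrow> real^'n::finite^'m) \<Rightarrow>
   ('k \<Rightarrow> real^'m \<Rightarrow> real) \<Rightarrow> real^'n \<Rightarrow> ('k \<Rightarrow> real^'m) \<Rightarrow> real^'k \<Rightarrow> real" where
  "lagrangian f\<^sub>0 I T g y p q =
     f\<^sub>0 y + (\<Sum>k\<in>UNIV. q $ k * ((T k *v y) \<bullet> p k - conj_val (I k) (g k) (p k)))"

lemma convex_on_lagrangian:
  assumes "convex_on X f\<^sub>0"
  shows "convex_on X (\<lambda>y. lagrangian f\<^sub>0 I T g y p q)"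
  unfolding lagrangian_def
proof (intro convex_on_add assms)
  let ?h = "\<lambda>y. \<Sum>k\<in>UNIV. q $ k * ((T k *v y) \<bullet> p k - conj_val (I k) (g k) (p k))"
  have "?h (u *\<^sub>R y + v *\<^sub>R z) = u * ?h y + v * ?h z" if "u + v = 1" for u v y z
  proof -
    have v: "v = 1 - u" using that by simp
    show ?thesis unfolding sum_distrib_left sum.distrib[symmetric]
      by (rule sum.cong) (auto simp: v matrix_vector_right_distrib matrix_vector_mult_scaleR
          inner_add_left algebra_simps)
  qed
  then show "convex_on X ?h"
    using convex_on_imp_convex[OF assms] by (simp add: convex_on_def)
qed

text \<open>Expansion of a square. It splits a product of a primal move and a dual change between
  two proximal terms, with weight \<open>\<sigma>\<close> for the \<pi> block and
  \<open>\<kappa>\<close> for the plans.\<close>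

lemma weighted_am_gm:
  fixes u v c :: real
  assumes "0 < c"
  shows "u * v \<le> u\<^sup>2 / (2 * c) + c * v\<^sup>2 / 2"
proof -
  have "0 \<le> (u - c * v)\<^sup>2 / (2 * c)" using assms by simp
  also have "\<dots> = u\<^sup>2 / (2 * c) - u * v + c * v\<^sup>2 / 2"
    using assms by (simp add: field_simps power2_eq_square)
  finally show ?thesis by simp
qed

text \<open>The potential consists of the three distances to the comparison point, the part of the
  extrapolation errors which telescopes, and a multiple of the last primal step, large enough to
  absorb the part which does not telescope.\<close>

lemma sd_gap_sum:
  fixes X :: "(real^'n::finite) set" and H :: "nat \<Rightarrow> real^'k::finite^'k"
    and T :: "'k \<Rightarrow> real^'n^'m::finite" and x :: "nat \<Rightarrow> real^'n" and p :: "'k \<Rightarrow> real^'m"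
  assumes f0: "convex_on X f\<^sub>0"
    and run: "sd_iterates W X f\<^sub>0 I T g D \<delta> \<sigma> \<tau>\<^sub>q \<eta> N x \<pi> H"
    and pos: "0 < \<sigma>" "0 < \<tau>\<^sub>q" "0 < \<kappa>" "0 \<le> \<eta>"
    and M\<^sub>T: "0 \<le> M\<^sub>T" "\<And>k y. norm (T k *v y) \<le> M\<^sub>T * norm y"
    and M\<^sub>\<Pi>: "\<And>k p. p \<in> dual_dom (I k) (g k) \<Longrightarrow> norm p \<le> M\<^sub>\<Pi>"
    and prox: "\<And>t. t \<in> {1..N} \<Longrightarrow>
      col_sums G \<bullet> f_tilde I T g x \<pi> t + \<tau>\<^sub>q * mat_dist W (H (t - 1)) (H t) + \<tau>\<^sub>q * mat_dist W (H t) G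
      \<le> col_sums (H t) \<bullet> f_tilde I T g x \<pi> t + \<tau>\<^sub>q * mat_dist W (H (t - 1)) G"
    and strong: "\<And>t F. t \<le> N \<Longrightarrow> F \<in> transport_plans D \<delta> \<Longrightarrow>
      \<kappa> * (\<Sum>k\<in>UNIV. \<bar>col_sums F $ k - col_sums (H t) $ k\<bar>)\<^sup>2 \<le> 2 * (\<tau>\<^sub>q * mat_dist W (H t) F)"
    and \<eta>: "M\<^sub>T\<^sup>2 / \<sigma> + (M\<^sub>T * M\<^sub>\<Pi>)\<^sup>2 / \<kappa> \<le> \<eta>"
    and G: "G \<in> transport_plans D \<delta>" and p: "\<And>k. p k \<in> dual_dom (I k) (g k)" and y: "y \<in> X"
  shows "(\<Sum>t=1..N. lagrangian f\<^sub>0 I T g (x t) p (col_sums G) - lagrangian f\<^sub>0 I T g y (\<pi> t) (col_sums (H t)))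
    \<le> \<sigma> * (\<Sum>k\<in>UNIV. col_sums G $ k * half_sq_dist (\<pi> 0 k) (p k))
      + \<tau>\<^sub>q * mat_dist W (H 0) G + \<eta> * half_sq_dist (x 0) y"
proof -
  let ?L = "lagrangian f\<^sub>0 I T g"
  define q where "q = col_sums G"
  define qq where "qq t = col_sums (H t)" for t
  define \<phi> where "\<phi> k = conj_val (I k) (g k)" for k
  \<comment> \<open>Natural subtraction gives \<open>a 0 k = 0\<close>, hence \<open>b\<close>,
    \<open>d\<close> and \<open>V\<close> vanish at 0 as well; this encodes the convention that the
    point before \<open>x 0\<close> is \<open>x 0\<close>.\<close>
  define a where "a t k = T k *v (x t - x (t - 1))" for t k
  define U where "U t k = half_sq_dist (\<pi> t k) (p k)" for t k
  define b where "b t k = a t k \<bullet> \<pi> t k" for t k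
  define d where "d t k = a t k \<bullet> (p k - \<pi> t k)" for t k
  define V where "V t = half_sq_dist (x (t - 1)) (x t)" for t
  \<comment> \<open>The prices, in units of \<open>V\<close>, of absorbing a product with a change
    of \<pi> (\<open>\<alpha>\<close>) and with a change of the column sums
    (\<open>\<beta>\<close>); the stepsize condition says that \<open>\<eta>\<close> covers
    both.\<close>
  define \<alpha> where "\<alpha> = M\<^sub>T\<^sup>2 / \<sigma>"
  define \<beta> where "\<beta> = (M\<^sub>T * M\<^sub>\<Pi>)\<^sup>2 / \<kappa>"
  define \<Phi> where "\<Phi> t = (\<Sum>k\<in>UNIV. q $ k * (\<sigma> * U t k - d t k)) + \<tau>\<^sub>q * mat_dist W (H t) G
      - (\<Sum>k\<in>UNIV. (q $ k - qq t $ k) * b t k) + \<eta> * half_sq_dist (x t) y + (\<alpha> + \<beta>) * V t" for t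

  have q0: "0 \<le> q $ k" for k unfolding q_def by (rule col_sums_nonneg[OF G])
  have q1: "(\<Sum>k\<in>UNIV. q $ k) = 1" unfolding q_def by (rule sum_col_sums[OF G])
  have dom: "\<pi> t k \<in> dual_dom (I k) (g k)" if "t \<le> N" for t k
    using run that by (cases "t = 0") (auto simp: sd_iterates_def is_arg_max_def)
  have M\<^sub>\<Pi>0: "0 \<le> M\<^sub>\<Pi>" using M\<^sub>\<Pi>[OF p] norm_ge_zero order_trans by blast

  have a_young: "a t k \<bullet> w \<le> \<alpha> * V t + \<sigma> * (norm w)\<^sup>2 / 2" for t k w
  proof -
    have "a t k \<bullet> w \<le> norm (a t k) * norm w" by (rule norm_cauchy_schwarz)
    also have "\<dots> \<le> (M\<^sub>T * norm (x t - x (t - 1))) * norm w"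
      unfolding a_def by (intro mult_right_mono M\<^sub>T) auto
    also have "\<dots> \<le> (M\<^sub>T * norm (x t - x (t - 1)))\<^sup>2 / (2 * \<sigma>) + \<sigma> * (norm w)\<^sup>2 / 2"
      by (rule weighted_am_gm) fact
    also have "(M\<^sub>T * norm (x t - x (t - 1)))\<^sup>2 / (2 * \<sigma>) = \<alpha> * V t"
      by (simp add: \<alpha>_def V_def half_sq_dist_def power_mult_distrib norm_minus_commute)
    finally show ?thesis .
  qed
  \<comment> \<open>Hoelder's inequality: the \<open>b t k\<close> are bounded uniformly in
    \<open>k\<close>, so the weights enter through their l1 distance, which \<open>strong\<close>
    controls.\<close>
  have b_young: "(\<Sum>k\<in>UNIV. (col_sums F $ k - qq t $ k) * b t k) \<le> \<beta> * V t + \<tau>\<^sub>q * mat_dist W (H t) F"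
    if t: "t \<le> N" and F: "F \<in> transport_plans D \<delta>" for t F
  proof -
    let ?n = "norm (x t - x (t - 1))" and ?l = "\<Sum>k\<in>UNIV. \<bar>col_sums F $ k - qq t $ k\<bar>"
    have b: "\<bar>b t k\<bar> \<le> M\<^sub>T * M\<^sub>\<Pi> * ?n" for k
    proof -
      have "\<bar>b t k\<bar> \<le> norm (a t k) * norm (\<pi> t k)" unfolding b_def by (rule Cauchy_Schwarz_ineq2)
      also have "\<dots> \<le> (M\<^sub>T * ?n) * M\<^sub>\<Pi>"
        unfolding a_def using M\<^sub>T by (intro mult_mono M\<^sub>\<Pi>[OF dom[OF t]]) auto
      finally show ?thesis by (simp add: mult_ac)
    qed
    have "(\<Sum>k\<in>UNIV. (col_sums F $ k - qq t $ k) * b t k)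
        \<le> (\<Sum>k\<in>UNIV. M\<^sub>T * M\<^sub>\<Pi> * ?n * \<bar>col_sums F $ k - qq t $ k\<bar>)"
    proof (rule sum_mono)
      fix k
      have "(col_sums F $ k - qq t $ k) * b t k \<le> \<bar>b t k\<bar> * \<bar>col_sums F $ k - qq t $ k\<bar>"
        by (metis abs_ge_self abs_mult mult.commute)
      also have "\<dots> \<le> M\<^sub>T * M\<^sub>\<Pi> * ?n * \<bar>col_sums F $ k - qq t $ k\<bar>"
        by (intro mult_right_mono b) auto
      finally show "(col_sums F $ k - qq t $ k) * b t k \<le> M\<^sub>T * M\<^sub>\<Pi> * ?n * \<bar>col_sums F $ k - qq t $ k\<bar>" .
    qed
    also have "\<dots> = M\<^sub>T * M\<^sub>\<Pi> * ?n * ?l" by (simp add: sum_distrib_left)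
    also have "\<dots> \<le> (M\<^sub>T * M\<^sub>\<Pi> * ?n)\<^sup>2 / (2 * \<kappa>) + \<kappa> * ?l\<^sup>2 / 2"
      by (rule weighted_am_gm) fact
    also have "(M\<^sub>T * M\<^sub>\<Pi> * ?n)\<^sup>2 / (2 * \<kappa>) = \<beta> * V t"
      by (simp add: \<beta>_def V_def half_sq_dist_def power_mult_distrib norm_minus_commute)
    also have "\<kappa> * ?l\<^sup>2 / 2 \<le> \<tau>\<^sub>q * mat_dist W (H t) F"
      using strong[OF t F] by (simp add: qq_def)
    finally show ?thesis by simp
  qed

  have step: "?L (x t) p q - ?L y (\<pi> t) (qq t) \<le> \<Phi> (t - 1) - \<Phi> t" if t: "t \<in> {1..N}" for t
  proof -
    have x_min: "is_arg_min (\<lambda>y. f\<^sub>0 y + (\<Sum>k\<in>UNIV. qq t $ k * ((T k *v y) \<bullet> \<pi> t k))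
          + \<eta> * half_sq_dist (x (t - 1)) y) (\<lambda>y. y \<in> X) (x t)"
      and \<pi>_max: "\<And>k. is_arg_max (\<lambda>p. (T k *v extrapolated x t) \<bullet> p - conj_val (I k) (g k) p
          - \<sigma> * half_sq_dist (\<pi> (t - 1) k) p) (\<lambda>p. p \<in> dual_dom (I k) (g k)) (\<pi> t k)"
      and H_dom: "H t \<in> transport_plans D \<delta>"
      using run t unfolding sd_iterates_def qq_def is_arg_max_def[of _ "\<lambda>G. G \<in> transport_plans D \<delta>"]
      by blast+
    have split: "?L z (\<pi> t) (qq t) = f\<^sub>0 z + (\<Sum>k\<in>UNIV. qq t $ k * ((T k *v z) \<bullet> \<pi> t k))
        - (\<Sum>k\<in>UNIV. qq t $ k * \<phi> k (\<pi> t k))" for z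
      by (simp add: lagrangian_def \<phi>_def right_diff_distrib sum_subtractf)
    have x_step: "?L (x t) (\<pi> t) (qq t) + \<eta> * V t + \<eta> * half_sq_dist (x t) y
        \<le> ?L y (\<pi> t) (qq t) + \<eta> * half_sq_dist (x (t - 1)) y"
      unfolding V_def
    proof (rule half_sq_dist_prox[OF convex_on_lagrangian[OF f0]])
      show "x t \<in> X" using x_min by (simp add: is_arg_min_def)
      show "?L (x t) (\<pi> t) (qq t) + \<eta> * half_sq_dist (x (t - 1)) (x t)
          \<le> ?L w (\<pi> t) (qq t) + \<eta> * half_sq_dist (x (t - 1)) w" if "w \<in> X" for w
        using x_min that unfolding split is_arg_min_linorder by auto
    qed fact
    have \<pi>_step: "(T k *v x t) \<bullet> (p k - \<pi> t k) - \<phi> k (p k) + \<phi> k (\<pi> t k)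
        \<le> \<sigma> * U (t - 1) k - \<sigma> * U t k + d t k - d (t - 1) k + \<alpha> * V (t - 1)" for k
    proof -
      let ?z = "T k *v extrapolated x t"
      have "\<phi> k (\<pi> t k) - ?z \<bullet> \<pi> t k + \<sigma> * half_sq_dist (\<pi> (t - 1) k) (\<pi> t k) + \<sigma> * U t k
          \<le> \<phi> k (p k) - ?z \<bullet> p k + \<sigma> * U (t - 1) k"
        unfolding U_def
      proof (rule half_sq_dist_prox[where S = "dual_dom (I k) (g k)"])
        have "convex_on (dual_dom (I k) (g k)) (\<lambda>v. - (?z \<bullet> v))"
          using convex_on_imp_convex[OF convex_on_conj_val]
          by (simp add: convex_on_def inner_add_right)
        from convex_on_add[OF convex_on_conj_val this]
        show "convex_on (dual_dom (I k) (g k)) (\<lambda>v. \<phi> k v - ?z \<bullet> v)" by (simp add: \<phi>_def)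
        show "\<pi> t k \<in> dual_dom (I k) (g k)" using dom t by simp
        show "\<phi> k (\<pi> t k) - ?z \<bullet> \<pi> t k + \<sigma> * half_sq_dist (\<pi> (t - 1) k) (\<pi> t k)
            \<le> \<phi> k w - ?z \<bullet> w + \<sigma> * half_sq_dist (\<pi> (t - 1) k) w"
          if "w \<in> dual_dom (I k) (g k)" for w
          using \<pi>_max[of k] that unfolding is_arg_max_linorder \<phi>_def by fastforce
      qed fact
      \<comment> \<open>Extrapolation predicts \<open>x t\<close> by repeating the previous move, so
        the prediction error is the difference of two successive moves.\<close>
      moreover have "?z = T k *v x t - a t k + a (t - 1) k"
      proof -
        have "extrapolated x t = x t - (x t - x (t - 1)) + (x (t - 1) - x (t - 1 - 1))"
          unfolding extrapolated_def by (simp add: scaleR_2 numeral_2_eq_2)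
        then show ?thesis
          unfolding a_def by (simp only: matrix_vector_mult_diff_distrib matrix_vector_right_distrib)
      qed
      \<comment> \<open>The old move paired with \<open>p k - \<pi> t k\<close> is split at
        \<open>\<pi> (t - 1) k\<close>: one part telescopes as \<open>d\<close>, the other is a
        product with a change of \<pi>.\<close>
      then have "(T k *v x t) \<bullet> (p k - \<pi> t k) = ?z \<bullet> p k - ?z \<bullet> \<pi> t k + d t k - d (t - 1) k
          + a (t - 1) k \<bullet> (\<pi> t k - \<pi> (t - 1) k)"
        unfolding d_def by (simp add: inner_diff_left inner_diff_right inner_add_left)
      moreover have "a (t - 1) k \<bullet> (\<pi> t k - \<pi> (t - 1) k)
          \<le> \<alpha> * V (t - 1) + \<sigma> * half_sq_dist (\<pi> (t - 1) k) (\<pi> t k)"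
        using a_young[of "t - 1" k "\<pi> t k - \<pi> (t - 1) k"]
        by (simp add: half_sq_dist_def norm_minus_commute)
      ultimately show ?thesis by linarith
    qed
    have "?L (x t) p q - ?L (x t) (\<pi> t) q
        = (\<Sum>k\<in>UNIV. q $ k * ((T k *v x t) \<bullet> (p k - \<pi> t k) - \<phi> k (p k) + \<phi> k (\<pi> t k)))"
      unfolding lagrangian_def \<phi>_def add_diff_cancel_left sum_subtractf[symmetric]
      by (rule sum.cong) (auto simp: inner_diff_right algebra_simps)
    also have "\<dots> \<le> (\<Sum>k\<in>UNIV. q $ k * (\<sigma> * U (t - 1) k - \<sigma> * U t k + d t k - d (t - 1) k + \<alpha> * V (t - 1)))"
      by (intro sum_mono mult_left_mono \<pi>_step q0)
    also have "\<dots> = (\<Sum>k\<in>UNIV. q $ k * (\<sigma> * U (t - 1) k - d (t - 1) k))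
        - (\<Sum>k\<in>UNIV. q $ k * (\<sigma> * U t k - d t k)) + (\<Sum>k\<in>UNIV. q $ k) * (\<alpha> * V (t - 1))"
      unfolding sum_subtractf[symmetric] sum_distrib_right sum.distrib[symmetric]
      by (rule sum.cong) (auto simp: algebra_simps)
    finally have dual_gap: "?L (x t) p q - ?L (x t) (\<pi> t) q
        \<le> (\<Sum>k\<in>UNIV. q $ k * (\<sigma> * U (t - 1) k - d (t - 1) k))
        - (\<Sum>k\<in>UNIV. q $ k * (\<sigma> * U t k - d t k)) + \<alpha> * V (t - 1)"
      by (simp add: q1)
    \<comment> \<open>The correction term makes \<open>f_tilde\<close> differ from the true
      coefficients at \<open>x t\<close> by exactly \<open>b (t - 1) k - b t k\<close>.\<close>
    have f_tilde: "f_tilde I T g x \<pi> t $ k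
        = (T k *v x t) \<bullet> \<pi> t k - \<phi> k (\<pi> t k) - b t k + b (t - 1) k" for k
    proof -
      have "T k *v x (t - 1) = T k *v x t - a t k"
        unfolding a_def by (simp add: matrix_vector_mult_diff_distrib)
      then show ?thesis
        by (simp add: f_tilde_def b_def a_def \<phi>_def inner_diff_left numeral_2_eq_2)
    qed
    \<comment> \<open>Rewriting the old error relative to \<open>qq (t - 1)\<close> instead of
      \<open>qq t\<close> makes it telescope; the last sum is the price.\<close>
    have "?L (x t) (\<pi> t) q - ?L (x t) (\<pi> t) (qq t)
        = (\<Sum>k\<in>UNIV. q $ k * f_tilde I T g x \<pi> t $ k) - (\<Sum>k\<in>UNIV. qq t $ k * f_tilde I T g x \<pi> t $ k)
        + (\<Sum>k\<in>UNIV. (q $ k - qq t $ k) * b t k)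
        - (\<Sum>k\<in>UNIV. (q $ k - qq (t - 1) $ k) * b (t - 1) k)
        + (\<Sum>k\<in>UNIV. (qq t $ k - qq (t - 1) $ k) * b (t - 1) k)"
      unfolding lagrangian_def add_diff_cancel_left sum_subtractf[symmetric] sum.distrib[symmetric] f_tilde
      by (rule sum.cong) (auto simp: \<phi>_def algebra_simps)
    also have "(\<Sum>k\<in>UNIV. q $ k * f_tilde I T g x \<pi> t $ k) - (\<Sum>k\<in>UNIV. qq t $ k * f_tilde I T g x \<pi> t $ k)
        \<le> \<tau>\<^sub>q * mat_dist W (H (t - 1)) G - \<tau>\<^sub>q * mat_dist W (H t) G - \<tau>\<^sub>q * mat_dist W (H (t - 1)) (H t)"
      using prox[OF t] by (simp add: q_def qq_def inner_vec_def)
    also have "(\<Sum>k\<in>UNIV. (qq t $ k - qq (t - 1) $ k) * b (t - 1) k)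
        \<le> \<beta> * V (t - 1) + \<tau>\<^sub>q * mat_dist W (H (t - 1)) (H t)"
      using b_young[of "t - 1", OF _ H_dom] t by (auto simp: qq_def)
    finally have plan_gap: "?L (x t) (\<pi> t) q - ?L (x t) (\<pi> t) (qq t)
        \<le> \<tau>\<^sub>q * mat_dist W (H (t - 1)) G - \<tau>\<^sub>q * mat_dist W (H t) G
        + (\<Sum>k\<in>UNIV. (q $ k - qq t $ k) * b t k)
        - (\<Sum>k\<in>UNIV. (q $ k - qq (t - 1) $ k) * b (t - 1) k) + \<beta> * V (t - 1)"
      by simp
    \<comment> \<open>The gain \<open>\<eta> * V t\<close> of the primal step pays for the new term
      of the potential.\<close>
    have "(\<alpha> + \<beta>) * V t \<le> \<eta> * V t"
      using \<eta> by (intro mult_right_mono) (auto simp: \<alpha>_def \<beta>_def V_def)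
    then show ?thesis
      using x_step dual_gap plan_gap unfolding \<Phi>_def distrib_right by linarith
  qed
  have "(\<Sum>t=1..n. ?L (x t) p q - ?L y (\<pi> t) (qq t)) \<le> \<Phi> 0 - \<Phi> n" if "n \<le> N" for n
    using that
  proof (induction n)
    case (Suc n)
    then show ?case using step[of "Suc n"] by simp
  qed simp
  then have sum: "(\<Sum>t=1..N. ?L (x t) p q - ?L y (\<pi> t) (qq t)) \<le> \<Phi> 0 - \<Phi> N" by simp
  \<comment> \<open>The cross terms of the final iterate are absorbed too: those with \<pi> by
    \<open>\<alpha> * V N\<close> and the \<sigma> terms, those with the column sums by
    \<open>\<beta> * V N\<close> and the matrix distance.\<close>
  have "0 \<le> \<Phi> N"
  proof -
    have "(\<Sum>k\<in>UNIV. q $ k * (- (\<alpha> * V N))) \<le> (\<Sum>k\<in>UNIV. q $ k * (\<sigma> * U N k - d N k))"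
    proof (intro sum_mono mult_left_mono q0)
      show "- (\<alpha> * V N) \<le> \<sigma> * U N k - d N k" for k
        using a_young[of N k "p k - \<pi> N k"]
        by (simp add: d_def U_def half_sq_dist_def norm_minus_commute)
    qed
    moreover have "(\<Sum>k\<in>UNIV. q $ k * (- (\<alpha> * V N))) = - (\<alpha> * V N)"
      unfolding sum_distrib_right[symmetric] q1 by simp
    moreover have "0 \<le> \<eta> * half_sq_dist (x N) y" using pos by simp
    ultimately show ?thesis
      using b_young[OF order_refl G] unfolding \<Phi>_def distrib_right q_def by linarith
  qed
  moreover have "\<Phi> 0 = \<sigma> * (\<Sum>k\<in>UNIV. q $ k * U 0 k) + \<tau>\<^sub>q * mat_dist W (H 0) G + \<eta> * half_sq_dist (x 0) y"
    unfolding \<Phi>_def by (simp add: b_def d_def a_def V_def sum_distrib_left mult_ac)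
  ultimately show ?thesis using sum by (simp add: q_def qq_def U_def)
qed

section \<open>The convergence bound for the averaged iterates\<close>

theorem corollary4p2:
  fixes X :: "(real^'n::finite) set"
    and f\<^sub>0 :: "real^'n \<Rightarrow> real"
    and I :: "'k::finite \<Rightarrow> 'm::finite set"
    and T :: "'k \<Rightarrow> real^'n^'m"
    and g :: "'k \<Rightarrow> real^'m \<Rightarrow> real"
    and D :: "real^'k^'k"
    and \<delta> \<sigma> \<tau>\<^sub>q \<eta> :: real
    and W :: distance
    and N :: nat
    and x :: "nat \<Rightarrow> real^'n"
    and \<pi> :: "nat \<Rightarrow> 'k \<Rightarrow> real^'m"
    and H :: "nat \<Rightarrow> real^'k^'k"
    and x_opt x_bar :: "real^'n"
    and f :: "real^'n \<Rightarrow> real"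
    and K \<Omega>\<^sub>X \<Omega>\<^sub>\<Pi> \<Omega>\<^sub>H \<Omega>\<^sub>P M\<^sub>T M\<^sub>\<Pi> C\<^sub>p \<tau> :: real
  assumes X: "X \<noteq> {}" "convex X" "compact X"
    and f0: "convex_on X f\<^sub>0" "closed (epigraph X f\<^sub>0)" "\<exists>L. L-lipschitz_on X f\<^sub>0"
    and T: "\<And>k i. i \<notin> I k \<Longrightarrow> T k $ i = 0"
    and g: "\<And>k. convex_on (coord_space (I k)) (g k)"
           "\<And>k. \<exists>L. L-lipschitz_on (coord_space (I k)) (g k)"
    and D: "\<And>i j. 0 \<le> D $ i $ j" "0 \<le> \<delta>" "transport_plans D \<delta> \<noteq> {}"
    and f: "f = risk_objective f\<^sub>0 T g D \<delta>"
    and x_opt: "is_arg_min f (\<lambda>y. y \<in> X) x_opt"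
    and steps: "0 < \<sigma>" "0 < \<tau>\<^sub>q" "0 < \<eta>"
    and N: "1 \<le> N"
    and run: "sd_iterates W X f\<^sub>0 I T g D \<delta> \<sigma> \<tau>\<^sub>q \<eta> N x \<pi> H"
    and entropy_defined: "W = Entropy \<Longrightarrow> \<forall>t<N. \<forall>i j. 0 < H t $ i $ j"
    and x_bar: "x_bar = (1 / real N) *\<^sub>R (\<Sum>t=1..N. x t)"
    and K: "K = real CARD('k)"
    and \<Omega>\<^sub>X: "\<Omega>\<^sub>X = sqrt (SUP y\<in>X. half_sq_dist (x 0) y)"
    and \<Omega>\<^sub>\<Pi>: "\<Omega>\<^sub>\<Pi> = sqrt (MAX k. SUP p\<in>dual_dom (I k) (g k). half_sq_dist (\<pi> 0 k) p)"
    and \<Omega>\<^sub>H: "\<Omega>\<^sub>H = sqrt (SUP G\<in>transport_plans D \<delta>. mat_dist W (H 0) G)"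
    and M\<^sub>T: "M\<^sub>T = (MAX k. onorm (\<lambda>y. T k *v y))"
    and M\<^sub>\<Pi>: "M\<^sub>\<Pi> = (MAX k. SUP p\<in>dual_dom (I k) (g k). norm p)"
    and C\<^sub>p: "C\<^sub>p = sqrt K"
    and \<tau>: "\<tau> = (case W of Entropy \<Rightarrow> \<tau>\<^sub>q | Euclidean \<Rightarrow> \<tau>\<^sub>q / K)"
    and \<Omega>\<^sub>P: "\<Omega>\<^sub>P = sqrt (case W of Entropy \<Rightarrow> \<Omega>\<^sub>H\<^sup>2 | Euclidean \<Rightarrow> K * \<Omega>\<^sub>H\<^sup>2)"
  shows "(\<eta> \<ge> C\<^sub>p\<^sup>2 * M\<^sub>T\<^sup>2 * M\<^sub>\<Pi>\<^sup>2 / \<tau> + M\<^sub>T\<^sup>2 / \<sigma> \<longrightarrow>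
            f x_bar - f x_opt \<le> (\<sigma> * \<Omega>\<^sub>\<Pi>\<^sup>2 + \<tau> * \<Omega>\<^sub>P\<^sup>2 + \<eta> * \<Omega>\<^sub>X\<^sup>2) / real N)
       \<and> (0 < \<Omega>\<^sub>X \<and> 0 < \<Omega>\<^sub>\<Pi> \<and> 0 < \<Omega>\<^sub>H \<and> 0 < M\<^sub>T \<and> 0 < M\<^sub>\<Pi> \<and>
          \<sigma> = M\<^sub>T * (\<Omega>\<^sub>X / \<Omega>\<^sub>\<Pi>) \<and>
          \<tau> = M\<^sub>T * M\<^sub>\<Pi> * C\<^sub>p * (\<Omega>\<^sub>X / \<Omega>\<^sub>P) \<and>
          \<eta> = M\<^sub>T * M\<^sub>\<Pi> * C\<^sub>p * (\<Omega>\<^sub>P / \<Omega>\<^sub>X) + M\<^sub>T * (\<Omega>\<^sub>\<Pi> / \<Omega>\<^sub>X) \<longrightarrow>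
            f x_bar - f x_opt \<le> 2 * \<Omega>\<^sub>X * M\<^sub>T / real N * (\<Omega>\<^sub>\<Pi> + C\<^sub>p * M\<^sub>\<Pi> * \<Omega>\<^sub>P))"
proof -
  have x0: "x 0 \<in> X" and \<pi>0: "\<And>k. \<pi> 0 k \<in> dual_dom (I k) (g k)"
    and H0: "H 0 = (\<chi> i j. 1 / (real CARD('k))\<^sup>2)"
    using run by (auto simp: sd_iterates_def)
  have xt: "x t \<in> X" and \<pi>t: "\<And>k. \<pi> t k \<in> dual_dom (I k) (g k)" and Ht: "H t \<in> transport_plans D \<delta>"
    and H_max: "is_arg_max (\<lambda>G. col_sums G \<bullet> f_tilde I T g x \<pi> t - \<tau>\<^sub>q * mat_dist W (H (t - 1)) G)
          (\<lambda>G. G \<in> transport_plans D \<delta>) (H t)"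
    if "t \<in> {1..N}" for t
    using run that unfolding sd_iterates_def is_arg_max_def is_arg_min_def by blast+
  have K_pos: "0 < K" "1 \<le> K" using K by (auto simp: Suc_le_eq)
  have \<tau>_pos: "0 < \<tau>" using \<tau> steps K_pos by (cases W) auto
  \<comment> \<open>\<open>H 0\<close> need not satisfy the cost constraint, only the row constraints.\<close>
  have H_nonneg: "0 \<le> H t $ i $ j" and H_rows: "(\<Sum>j\<in>UNIV. H t $ i $ j) = 1 / real CARD('k)"
    if "t \<le> N" for t i j
    using that Ht[of t] by (cases "t = 0"; auto simp: H0 power2_eq_square transport_plansD)+

  have prox: "col_sums G \<bullet> f_tilde I T g x \<pi> t + \<tau>\<^sub>q * mat_dist W (H (t - 1)) (H t) + \<tau>\<^sub>q * mat_dist W (H t) G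
      \<le> col_sums (H t) \<bullet> f_tilde I T g x \<pi> t + \<tau>\<^sub>q * mat_dist W (H (t - 1)) G"
    if t: "t \<in> {1..N}" and G: "G \<in> transport_plans D \<delta>" for t G
  proof (cases W)
    case Entropy
    have "0 < H (t - 1) $ i $ j" for i j using entropy_defined[OF Entropy] t by auto
    with mat_dist_Entropy_prox(2)[OF H_max[OF t, unfolded Entropy] G] steps show ?thesis
      by (simp add: Entropy)
  next
    case Euclidean
    then show ?thesis using mat_dist_Euclidean_prox[OF H_max[OF t, unfolded Euclidean] G] by simp
  qed
  \<comment> \<open>The hypothesis on the entropy distance says nothing about the last iterate, which may vanish
    at entries where every transport plan does.\<close>
  have supp: "G $ i $ j = 0"
    if W: "W = Entropy" and t: "t \<le> N" and G: "G \<in> transport_plans D \<delta>" and 0: "H t $ i $ j = 0" for t G i j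
  proof (cases "t = N")
    case True
    have "0 < H (N - 1) $ i $ j" for i j using entropy_defined[OF W] N by auto
    with mat_dist_Entropy_prox(1)[OF H_max[of N, unfolded W] G] steps N 0 show ?thesis
      by (auto simp: True)
  next
    case False
    then have "t < N" using t by simp
    with entropy_defined[OF W] 0 show ?thesis by (metis order_less_irrefl)
  qed
  \<comment> \<open>The modulus \<open>\<tau> / K\<close> serves both distances: it is at most
    \<open>\<tau>\<^sub>q\<close> for the entropy, and equals
    \<open>\<tau>\<^sub>q / K\<^sup>2\<close> in the Euclidean case, cancelling the number of
    entries. As \<open>C\<^sub>p\<^sup>2 = K\<close>, it also matches the condition on
    \<open>\<eta>\<close>.\<close>
  have strong: "\<tau> / K * (\<Sum>k\<in>UNIV. \<bar>col_sums F $ k - col_sums (H t) $ k\<bar>)\<^sup>2 \<le> 2 * (\<tau>\<^sub>q * mat_dist W (H t) F)"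
    if t: "t \<le> N" and F: "F \<in> transport_plans D \<delta>" for t F
  proof (cases W)
    case Entropy
    let ?S = "(\<Sum>k\<in>UNIV. \<bar>col_sums F $ k - col_sums (H t) $ k\<bar>)\<^sup>2"
    have "\<tau> / K * ?S \<le> \<tau>\<^sub>q * ?S"
      using \<tau> Entropy steps K_pos by (intro mult_right_mono) (auto simp: divide_le_eq)
    also have "?S \<le> 2 * mat_dist Entropy (H t) F"
      using F supp[OF Entropy t F] t H_nonneg H_rows transport_plansD
      by (intro mat_dist_Entropy_strong) blast+
    finally show ?thesis using Entropy steps by (simp add: mult_left_mono)
  next
    case Euclidean
    have "\<tau> / K * (\<Sum>k\<in>UNIV. \<bar>col_sums F $ k - col_sums (H t) $ k\<bar>)\<^sup>2
        \<le> \<tau> / K * (2 * K\<^sup>2 * mat_dist Euclidean (H t) F)"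
      using \<tau>_pos K_pos unfolding K by (intro mult_left_mono mat_dist_Euclidean_strong) auto
    then show ?thesis using Euclidean \<tau> K_pos by (simp add: power2_eq_square)
  qed

  \<comment> \<open>The constants as upper bounds\<close>
  have \<Omega>X_bound: "half_sq_dist (x 0) y \<le> \<Omega>\<^sub>X\<^sup>2" if "y \<in> X" for y
  proof -
    have "bdd_above (half_sq_dist (x 0) ` X)"
      using X unfolding half_sq_dist_def
      by (intro bounded_imp_bdd_above compact_imp_bounded compact_continuous_image continuous_intros) auto
    then have "half_sq_dist (x 0) z \<le> (SUP y\<in>X. half_sq_dist (x 0) y)" if "z \<in> X" for z
      using that by (rule cSUP_upper[rotated])
    \<comment> \<open>The value 0 at \<open>x 0\<close> makes the supremum nonnegative, so squaring
      undoes the square root.\<close>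
    from this[OF that] this[OF x0] show ?thesis by (simp add: \<Omega>\<^sub>X)
  qed
  obtain L where L: "\<And>k. (L k)-lipschitz_on (coord_space (I k)) (g k)"
    using g(2) by metis
  have dual_norm: "norm p \<le> L k" if "p \<in> dual_dom (I k) (g k)" for k p
    using norm_le_lipschitz_of_dual_dom[OF L that] .
  have \<Omega>\<Pi>_bound: "half_sq_dist (\<pi> 0 k) p \<le> \<Omega>\<^sub>\<Pi>\<^sup>2" if p: "p \<in> dual_dom (I k) (g k)" for k p
  proof -
    let ?s = "\<lambda>k. SUP p\<in>dual_dom (I k) (g k). half_sq_dist (\<pi> 0 k) p"
    have "half_sq_dist (\<pi> 0 k) w \<le> (L k + L k)\<^sup>2 / 2" if w: "w \<in> dual_dom (I k) (g k)" for w
      unfolding half_sq_dist_def using norm_triangle_ineq4[of "\<pi> 0 k" w] dual_norm[OF w] dual_norm[OF \<pi>0[of k]]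
      by (intro divide_right_mono power_mono) auto
    then have "bdd_above (half_sq_dist (\<pi> 0 k) ` dual_dom (I k) (g k))" by (rule bdd_aboveI2)
    from cSUP_upper[OF p this] have "half_sq_dist (\<pi> 0 k) p \<le> ?s k" .
    also have "?s k \<le> (MAX k. ?s k)" by (intro Max_ge) auto
    finally have "half_sq_dist (\<pi> 0 k) p \<le> (MAX k. ?s k)" .
    moreover from this have "0 \<le> (MAX k. ?s k)" using half_sq_dist_nonneg order_trans by blast
    ultimately show ?thesis by (simp add: \<Omega>\<^sub>\<Pi>)
  qed
  have M\<Pi>_bound: "norm p \<le> M\<^sub>\<Pi>" if p: "p \<in> dual_dom (I k) (g k)" for k p
  proof -
    let ?s = "\<lambda>k. SUP p\<in>dual_dom (I k) (g k). norm p"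
    have "bdd_above (norm ` dual_dom (I k) (g k))" using dual_norm by (rule bdd_aboveI2)
    from cSUP_upper[OF p this] have "norm p \<le> ?s k" .
    also have "?s k \<le> (MAX k. ?s k)" by (intro Max_ge) auto
    finally show ?thesis by (simp add: M\<^sub>\<Pi>)
  qed
  have onorm_le: "onorm (\<lambda>y. T k *v y) \<le> M\<^sub>T" for k unfolding M\<^sub>T by (intro Max_ge) auto
  have M\<^sub>T_nonneg: "0 \<le> M\<^sub>T"
    using onorm_le[of undefined] onorm_pos_le[OF matrix_vector_mul_bounded_linear[of "T undefined"]] by linarith
  have M\<^sub>T_bound: "norm (T k *v y) \<le> M\<^sub>T * norm y" for k y
    using onorm[OF matrix_vector_mul_bounded_linear, of "T k" y] onorm_le[of k]
    by (meson mult_right_mono norm_ge_zero order_trans)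
  have \<Omega>H_bound: "mat_dist W (H 0) G \<le> \<Omega>\<^sub>H\<^sup>2" if G: "G \<in> transport_plans D \<delta>" for G
  proof -
    \<comment> \<open>Individual entropy terms may be negative; the sign of their sum is read off
      from \<open>strong\<close>.\<close>
    have "0 \<le> \<tau> / K * (\<Sum>k\<in>UNIV. \<bar>col_sums G $ k - col_sums (H 0) $ k\<bar>)\<^sup>2"
      using \<tau>_pos K_pos by simp
    then have "0 \<le> \<tau>\<^sub>q * mat_dist W (H 0) G" using strong[OF le0 G] by linarith
    then have "0 \<le> mat_dist W (H 0) G" using steps by (simp add: zero_le_mult_iff)
    moreover have "mat_dist W (H 0) G \<le> (SUP G\<in>transport_plans D \<delta>. mat_dist W (H 0) G)"
      unfolding H0 by (rule cSUP_upper[OF G bdd_above_mat_dist])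
    ultimately show ?thesis by (simp add: \<Omega>\<^sub>H)
  qed
  have \<tau>\<Omega>P: "\<tau> * \<Omega>\<^sub>P\<^sup>2 = \<tau>\<^sub>q * \<Omega>\<^sub>H\<^sup>2"
    using \<tau> \<Omega>\<^sub>P K_pos by (cases W) auto

  have xbar: "x_bar = (\<Sum>t=1..N. (1 / real N) *\<^sub>R x t)" by (simp add: x_bar scaleR_sum_right)
  have weights: "(\<Sum>t=1..N. 1 / real N) = 1" using N by simp
  have xbar_X: "x_bar \<in> X"
    unfolding xbar using X xt weights by (intro convex_sum) auto
  have x_opt_X: "x_opt \<in> X" using x_opt by (simp add: is_arg_min_def)
  let ?L = "lagrangian f\<^sub>0 I T g"
  have T_coord: "T k *v y \<in> coord_space (I k)" for k y
    using T by (rule matrix_vector_in_coord_space)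
  \<comment> \<open>Weak duality. The column sums are at most 1, which bounds the expectations and
    makes the supremum over the ball genuine.\<close>
  have f_ge: "?L y p (col_sums G) \<le> f y"
    if G: "G \<in> transport_plans D \<delta>" and p: "\<And>k. p k \<in> dual_dom (I k) (g k)" for y p G
  proof -
    have "?L y p (col_sums G) \<le> f\<^sub>0 y + (\<Sum>k\<in>UNIV. col_sums G $ k * g k (T k *v y))"
      unfolding lagrangian_def
      by (intro add_left_mono sum_mono mult_left_mono fenchel_inequality p T_coord col_sums_nonneg[OF G])
    also have "\<dots> \<le> f y"
      unfolding f risk_objective_def
    proof (intro add_left_mono cSUP_upper)
      show "col_sums G \<in> kantorovich_ball D \<delta>" using G by (simp add: kantorovich_ball_def)
      have "(\<Sum>k\<in>UNIV. col_sums F $ k * g k (T k *v y)) \<le> (\<Sum>k\<in>UNIV. \<bar>g k (T k *v y)\<bar>)"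
        if F: "F \<in> transport_plans D \<delta>" for F
      proof (rule sum_mono)
        fix k
        have "col_sums F $ k \<le> (\<Sum>k\<in>UNIV. col_sums F $ k)"
          using col_sums_nonneg[OF F] by (intro member_le_sum) auto
        then have "col_sums F $ k \<le> 1" by (simp add: sum_col_sums[OF F])
        then have "col_sums F $ k * \<bar>g k (T k *v y)\<bar> \<le> 1 * \<bar>g k (T k *v y)\<bar>"
          by (intro mult_right_mono) auto
        moreover have "col_sums F $ k * g k (T k *v y) \<le> col_sums F $ k * \<bar>g k (T k *v y)\<bar>"
          using col_sums_nonneg[OF F] by (intro mult_left_mono) auto
        ultimately show "col_sums F $ k * g k (T k *v y) \<le> \<bar>g k (T k *v y)\<bar>" by simp
      qed
      then show "bdd_above ((\<lambda>p. \<Sum>k\<in>UNIV. p $ k * g k (T k *v y)) ` kantorovich_ball D \<delta>)"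
        unfolding kantorovich_ball_def image_image by (rule bdd_aboveI2)
    qed
    finally show ?thesis .
  qed
  \<comment> \<open>Strong duality at the average: the comparison point \<open>p\<close> depends on
    \<open>x_bar\<close> only, so a single choice serves all iterations and all plans.\<close>
  have "\<forall>k. \<exists>p. p \<in> dual_dom (I k) (g k) \<and>
      g k (T k *v x_bar) \<le> (T k *v x_bar) \<bullet> p - conj_val (I k) (g k) p"
    using fenchel_equality[OF g(1) T_coord] by metis
  then obtain p where p: "\<And>k. p k \<in> dual_dom (I k) (g k)"
    and p_eq: "\<And>k. g k (T k *v x_bar) \<le> (T k *v x_bar) \<bullet> p k - conj_val (I k) (g k) (p k)"
    by metis

  have bound: "f x_bar - f x_opt \<le> (\<sigma> * \<Omega>\<^sub>\<Pi>\<^sup>2 + \<tau> * \<Omega>\<^sub>P\<^sup>2 + \<eta> * \<Omega>\<^sub>X\<^sup>2) / real N"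
    if \<eta>: "C\<^sub>p\<^sup>2 * M\<^sub>T\<^sup>2 * M\<^sub>\<Pi>\<^sup>2 / \<tau> + M\<^sub>T\<^sup>2 / \<sigma> \<le> \<eta>"
  proof -
    let ?B = "\<sigma> * \<Omega>\<^sub>\<Pi>\<^sup>2 + \<tau> * \<Omega>\<^sub>P\<^sup>2 + \<eta> * \<Omega>\<^sub>X\<^sup>2"
    have \<eta>': "M\<^sub>T\<^sup>2 / \<sigma> + (M\<^sub>T * M\<^sub>\<Pi>)\<^sup>2 / (\<tau> / K) \<le> \<eta>"
      using \<eta> K_pos by (simp add: C\<^sub>p power_mult_distrib mult_ac)
    \<comment> \<open>The plan \<open>G\<close> is fixed here; the supremum over the ball is taken
      only after the iterates have been averaged.\<close>
    have gap: "f\<^sub>0 x_bar + (\<Sum>k\<in>UNIV. col_sums G $ k * g k (T k *v x_bar)) \<le> f x_opt + ?B / real N"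
      if G: "G \<in> transport_plans D \<delta>" for G
    proof -
      let ?q = "col_sums G"
      have "(\<Sum>t=1..N. ?L (x t) p ?q - ?L x_opt (\<pi> t) (col_sums (H t)))
          \<le> \<sigma> * (\<Sum>k\<in>UNIV. ?q $ k * half_sq_dist (\<pi> 0 k) (p k))
            + \<tau>\<^sub>q * mat_dist W (H 0) G + \<eta> * half_sq_dist (x 0) x_opt"
        using f0(1) run steps(1,2) divide_pos_pos[OF \<tau>_pos K_pos(1)] less_imp_le[OF steps(3)]
          M\<^sub>T_nonneg M\<^sub>T_bound M\<Pi>_bound prox[OF _ G] strong \<eta>' G p x_opt_X
        by (rule sd_gap_sum)
      also have "\<dots> \<le> ?B"
      proof -
        have "(\<Sum>k\<in>UNIV. ?q $ k * half_sq_dist (\<pi> 0 k) (p k)) \<le> (\<Sum>k\<in>UNIV. ?q $ k * \<Omega>\<^sub>\<Pi>\<^sup>2)"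
          by (intro sum_mono mult_left_mono \<Omega>\<Pi>_bound p col_sums_nonneg[OF G])
        also have "\<dots> = \<Omega>\<^sub>\<Pi>\<^sup>2" by (simp add: sum_col_sums[OF G] flip: sum_distrib_right)
        finally show ?thesis
          using \<Omega>H_bound[OF G] \<Omega>X_bound[OF x_opt_X] steps
          unfolding \<tau>\<Omega>P by (intro add_mono mult_left_mono) auto
      qed
      finally have sum: "(\<Sum>t=1..N. ?L (x t) p ?q) \<le> (\<Sum>t=1..N. ?L x_opt (\<pi> t) (col_sums (H t))) + ?B"
        by (simp add: sum_subtractf)
      have "(\<Sum>t=1..N. ?L x_opt (\<pi> t) (col_sums (H t))) \<le> (\<Sum>t=1..N. f x_opt)"
        by (intro sum_mono f_ge Ht \<pi>t)
      with sum have sum': "(\<Sum>t=1..N. ?L (x t) p ?q) \<le> real N * f x_opt + ?B" by simp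
      have "f\<^sub>0 x_bar + (\<Sum>k\<in>UNIV. ?q $ k * g k (T k *v x_bar)) \<le> ?L x_bar p ?q"
        unfolding lagrangian_def
        by (intro add_left_mono sum_mono mult_left_mono p_eq col_sums_nonneg[OF G])
      \<comment> \<open>Jensen's inequality in the primal variable, with \<open>p\<close> and the
        column sums fixed.\<close>
      also have "\<dots> \<le> (\<Sum>t=1..N. 1 / real N * ?L (x t) p ?q)"
        unfolding xbar using N xt weights
        by (intro convex_on_sum[OF _ _ convex_on_lagrangian[OF f0(1)]]) auto
      also have "\<dots> = (\<Sum>t=1..N. ?L (x t) p ?q) / real N" by (simp add: sum_divide_distrib)
      also have "\<dots> \<le> (real N * f x_opt + ?B) / real N" using sum' by (intro divide_right_mono) auto
      also have "\<dots> = f x_opt + ?B / real N" using N by (simp add: add_divide_distrib)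
      finally show ?thesis .
    qed
    have "(SUP q\<in>kantorovich_ball D \<delta>. \<Sum>k\<in>UNIV. q $ k * g k (T k *v x_bar))
        \<le> f x_opt + ?B / real N - f\<^sub>0 x_bar"
      using D(3) gap unfolding kantorovich_ball_def by (intro cSUP_least) (auto simp: algebra_simps)
    then show ?thesis by (simp add: f risk_objective_def)
  qed
  have special: "f x_bar - f x_opt \<le> 2 * \<Omega>\<^sub>X * M\<^sub>T / real N * (\<Omega>\<^sub>\<Pi> + C\<^sub>p * M\<^sub>\<Pi> * \<Omega>\<^sub>P)"
    if pos: "0 < \<Omega>\<^sub>X" "0 < \<Omega>\<^sub>\<Pi>" "0 < \<Omega>\<^sub>H" "0 < M\<^sub>T" "0 < M\<^sub>\<Pi>"
      and \<sigma>': "\<sigma> = M\<^sub>T * (\<Omega>\<^sub>X / \<Omega>\<^sub>\<Pi>)" and \<tau>': "\<tau> = M\<^sub>T * M\<^sub>\<Pi> * C\<^sub>p * (\<Omega>\<^sub>X / \<Omega>\<^sub>P)"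
      and \<eta>': "\<eta> = M\<^sub>T * M\<^sub>\<Pi> * C\<^sub>p * (\<Omega>\<^sub>P / \<Omega>\<^sub>X) + M\<^sub>T * (\<Omega>\<^sub>\<Pi> / \<Omega>\<^sub>X)"
  proof -
    have P_pos: "0 < \<Omega>\<^sub>P" using \<Omega>\<^sub>P pos K_pos by (cases W) auto
    have C_pos: "0 < C\<^sub>p" using C\<^sub>p K_pos by simp
    \<comment> \<open>These stepsizes meet the condition on \<open>\<eta>\<close> with
      equality.\<close>
    have "C\<^sub>p\<^sup>2 * M\<^sub>T\<^sup>2 * M\<^sub>\<Pi>\<^sup>2 / \<tau> + M\<^sub>T\<^sup>2 / \<sigma> = \<eta>"
      unfolding \<sigma>' \<tau>' \<eta>' using pos P_pos C_pos by (simp add: field_simps power2_eq_square)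
    then have "f x_bar - f x_opt \<le> (\<sigma> * \<Omega>\<^sub>\<Pi>\<^sup>2 + \<tau> * \<Omega>\<^sub>P\<^sup>2 + \<eta> * \<Omega>\<^sub>X\<^sup>2) / real N"
      by (intro bound) simp
    also have "\<sigma> * \<Omega>\<^sub>\<Pi>\<^sup>2 + \<tau> * \<Omega>\<^sub>P\<^sup>2 + \<eta> * \<Omega>\<^sub>X\<^sup>2 = 2 * \<Omega>\<^sub>X * M\<^sub>T * (\<Omega>\<^sub>\<Pi> + C\<^sub>p * M\<^sub>\<Pi> * \<Omega>\<^sub>P)"
      unfolding \<sigma>' \<tau>' \<eta>' using pos P_pos by (simp add: field_simps power2_eq_square)
    finally show ?thesis by simp
  qed
  show ?thesis using bound special by blast
qed

end
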